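(* Let $n\geq 2$, let $N$ be any Kähler manifold, and let $f:\mathbb{C}^{n}\to N$ be a harmonic map. Let $e(f)$ be the energy density of $f$ and $e''(f)$ the $\bar\partial$-energy density of $f$. Suppose that for some $\alpha>0$ $$e(f)(p)\,e''(f)(p)=O\left(\frac{1}{R^{4n+\alpha}}\right),$$ where $R=|p|$ denotes the distance from the origin to $p\in\mathbb{C}^n$; that is, there exist constants $C>0$ and $R_0>0$ such that $e(f)(p)\,e''(f)(p)\leq C\,|p|^{-(4n+\alpha)}$ for all $p\in\mathbb{C}^{n}$ with $|p|\geq R_0$. Then $f$ is a holomorphic map.
   Context: $\mathbb{C}^n$ carries its standard flat Hermitian (Euclidean) metric and standard complex structure $J$; $N$ is a Kähler manifold with complex structure $J'$ and Kähler metric $\langle\cdot,\cdot\rangle$. No curvature or completeness assumption is made on $N$. For a smooth map $f:\mathbb{C}^n\to N$ with differential $f_*$, and an orthonormal frame $\{e_i,Je_i\}_{i=1}^n$ of $\mathbb{C}^n$, the energy density is $$e(f)=\frac12\sum_{i=1}^n\left(|f_*e_i|^2+|f_*Je_i|^2\right),$$ and the $\bar\partial$-energy density is $$e''(f)=|\bar\partial f|^2=\frac14\sum_{i=1}^n\left(|f_*e_i|^2+|f_*Je_i|^2-2\langle J'f_*e_i,f_*Je_i\rangle\right).$$ The map $f$ is harmonic if its tension field $\tau(f)$ vanishes, where $\tau(f)$ is the trace $\sum_a(\nabla_{\epsilon_a}df)(\epsilon_a)$ over an orthonormal frame $\{\epsilon_a\}_{a=1}^{2n}$ of $\mathbb{C}^n$,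 with $\nabla$ the connection induced by the Levi-Civita connections of $\mathbb{C}^n$ and $N$. The map $f$ is holomorphic if $f_*J=J'f_*$ (equivalently, $|\bar\partial f|^2\equiv0$). *)

theory Defs
  imports "HOL-Analysis.Analysis"
begin

section \<open>Smooth maps between Euclidean spaces\<close>

primrec times_differentiable_on ::
  "nat \<Rightarrow> ('e::euclidean_space \<Rightarrow> 'b::real_normed_vector) \<Rightarrow> 'e set \<Rightarrow> bool" where
  "times_differentiable_on 0 F S \<longleftrightarrow> continuous_on S F"
| "times_differentiable_on (Suc k) F S \<longleftrightarrow>
     (\<forall>x\<in>S. F differentiable at x) \<and>
     (\<forall>v. times_differentiable_on k (\<lambda>x. frechet_derivative F (at x) v) S)"

text \<open>Only used for open \<open>S\<close>.\<close>

definition smooth_on :: "('e::euclidean_space \<Rightarrow> 'b::real_normed_vector) \<Rightarrow> 'e set \<Rightarrow> bool" where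
  "smooth_on F S \<longleftrightarrow> (\<forall>k. times_differentiable_on k F S)"


section \<open>Kaehler manifolds\<close>

text \<open>
  Manifolds are given by holomorphic atlases with values in \<open>\<complex>\<^sup>m\<close>, and
  tensors by their components in the charts. In every chart the tangent spaces are identified with
  \<open>\<complex>\<^sup>m\<close>, regarded as a real vector space, and the complex structure is \<open>v \<mapsto> \<i> *s v\<close>.
  The field \<open>metric_in\<close> sends a chart \<open>c\<close>, a point of the image of \<open>c\<close> and two tangent vectors
  in the coordinates of \<open>c\<close> to the value of the Riemannian metric, i.e. to the real part of
  the Hermitian metric.
\<close>

record ('a, 'm::finite) chart =
  chart_dom :: "'a set"
  chart_map :: "'a \<Rightarrow> complex ^ 'm"

record ('a, 'm::finite) metric_manifold =
  points :: "'a topology"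
  atlas :: "('a, 'm) chart set"
  metric_in :: "('a, 'm) chart \<Rightarrow> complex ^ 'm \<Rightarrow> complex ^ 'm \<Rightarrow> complex ^ 'm \<Rightarrow> real"

definition chart_img :: "('a, 'm) chart \<Rightarrow> (complex ^ 'm) set" where
  "chart_img c = chart_map c ` chart_dom c"

definition chart_on :: "'a topology \<Rightarrow> ('a, 'm::finite) chart \<Rightarrow> bool" where
  "chart_on X c \<longleftrightarrow>
     openin X (chart_dom c) \<and> open (chart_img c) \<and>
     homeomorphic_map (subtopology X (chart_dom c)) (top_of_set (chart_img c)) (chart_map c)"

definition transition ::
  "('a, 'm) chart \<Rightarrow> ('a, 'm) chart \<Rightarrow> complex ^ 'm \<Rightarrow> complex ^ 'm" where
  "transition c d = chart_map d \<circ> inv_into (chart_dom c) (chart_map c)"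

definition complex_differentiable_at ::
  "(complex ^ 'k::finite \<Rightarrow> complex ^ 'm::finite) \<Rightarrow> complex ^ 'k \<Rightarrow> bool" where
  "complex_differentiable_at F x \<longleftrightarrow>
     (\<exists>D. (F has_derivative D) (at x) \<and> (\<forall>v. D (\<i> *s v) = \<i> *s D v))"

definition complex_manifold :: "('a, 'm::finite) metric_manifold \<Rightarrow> bool" where
  "complex_manifold N \<longleftrightarrow>
     Hausdorff_space (points N) \<and> second_countable (points N) \<and>
     (\<forall>c\<in>atlas N. chart_on (points N) c) \<and>
     (\<Union>c\<in>atlas N. chart_dom c) = topspace (points N) \<and>
     (\<forall>c\<in>atlas N. \<forall>d\<in>atlas N. \<forall>q\<in>chart_dom c \<inter> chart_dom d.
        complex_differentiable_at (transition c d) (chart_map c q))"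

definition riemannian_metric :: "('a, 'm::finite) metric_manifold \<Rightarrow> bool" where
  "riemannian_metric N \<longleftrightarrow>
     (\<forall>c\<in>atlas N.
        (\<forall>x\<in>chart_img c.
           bilinear (metric_in N c x) \<and>
           (\<forall>v w. metric_in N c x v w = metric_in N c x w v) \<and>
           (\<forall>v. v \<noteq> 0 \<longrightarrow> 0 < metric_in N c x v v)) \<and>
        (\<forall>v w. smooth_on (\<lambda>x. metric_in N c x v w) (chart_img c))) \<and>
     (\<forall>c\<in>atlas N. \<forall>d\<in>atlas N. \<forall>q\<in>chart_dom c \<inter> chart_dom d. \<forall>v w.
        metric_in N c (chart_map c q) v w =
        metric_in N d (chart_map d q)
          (frechet_derivative (transition c d) (at (chart_map c q)) v)
          (frechet_derivative (transition c d) (at (chart_map c q)) w))"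

definition hermitian_metric :: "('a, 'm::finite) metric_manifold \<Rightarrow> bool" where
  "hermitian_metric N \<longleftrightarrow>
     riemannian_metric N \<and>
     (\<forall>c\<in>atlas N. \<forall>x\<in>chart_img c. \<forall>v w.
        metric_in N c x (\<i> *s v) (\<i> *s w) = metric_in N c x v w)"

definition kaehler_form ::
  "('a, 'm) metric_manifold \<Rightarrow> ('a, 'm) chart \<Rightarrow>
    complex ^ 'm \<Rightarrow> complex ^ 'm \<Rightarrow> complex ^ 'm \<Rightarrow> real" where
  "kaehler_form N c x v w = metric_in N c x (\<i> *s v) w"

text \<open>The last condition below is \<open>d\<omega> = 0\<close>, evaluated on constant vector fields \<open>u\<close>, \<open>v\<close>, \<open>w\<close>.\<close>

definition kaehler_manifold :: "('a, 'm::finite) metric_manifold \<Rightarrow> bool" where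
  "kaehler_manifold N \<longleftrightarrow>
     complex_manifold N \<and> hermitian_metric N \<and>
     (\<forall>c\<in>atlas N. \<forall>x\<in>chart_img c. \<forall>u v w.
        frechet_derivative (\<lambda>y. kaehler_form N c y v w) (at x) u +
        frechet_derivative (\<lambda>y. kaehler_form N c y w u) (at x) v +
        frechet_derivative (\<lambda>y. kaehler_form N c y u v) (at x) w = 0)"

text \<open>
  The Christoffel symbol \<open>\<Gamma>\<^sub>x(u, v) = \<nabla>\<^sub>u v\<close> of the Levi-Civita connection, for constant vector fields
  \<open>u\<close>, \<open>v\<close> in the chart \<open>c\<close>, is determined by the Koszul formula.
\<close>

definition christoffel ::
  "('a, 'm::finite) metric_manifold \<Rightarrow> ('a, 'm) chart \<Rightarrow>
    complex ^ 'm \<Rightarrow> complex ^ 'm \<Rightarrow> complex ^ 'm \<Rightarrow> complex ^ 'm" where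
  "christoffel N c x u v =
     (THE z. \<forall>w. 2 * metric_in N c x z w =
        frechet_derivative (\<lambda>y. metric_in N c y v w) (at x) u +
        frechet_derivative (\<lambda>y. metric_in N c y u w) (at x) v -
        frechet_derivative (\<lambda>y. metric_in N c y u v) (at x) w)"


section \<open>Maps from complex Euclidean space to a manifold\<close>

definition smooth_map ::
  "('a, 'm::finite) metric_manifold \<Rightarrow> (complex ^ 'n::finite \<Rightarrow> 'a) \<Rightarrow> bool" where
  "smooth_map N f \<longleftrightarrow>
     continuous_map euclidean (points N) f \<and>
     (\<forall>c\<in>atlas N. smooth_on (chart_map c \<circ> f) (f -` chart_dom c))"

text \<open>
  In the following definitions with a chart argument \<open>c\<close>, the point \<open>f p\<close> is to lie in the domain
  of \<open>c\<close>; \<open>differential c f p v\<close> is \<open>f\<^sub>* v\<close> in the coordinates of \<open>c\<close>.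
\<close>

definition differential ::
  "('a, 'm::finite) chart \<Rightarrow> (complex ^ 'n::finite \<Rightarrow> 'a) \<Rightarrow>
    complex ^ 'n \<Rightarrow> complex ^ 'n \<Rightarrow> complex ^ 'm" where
  "differential c f p v = frechet_derivative (chart_map c \<circ> f) (at p) v"

definition holomorphic_map ::
  "('a, 'm::finite) metric_manifold \<Rightarrow> (complex ^ 'n::finite \<Rightarrow> 'a) \<Rightarrow> bool" where
  "holomorphic_map N f \<longleftrightarrow>
     smooth_map N f \<and>
     (\<forall>c\<in>atlas N. \<forall>p. f p \<in> chart_dom c \<longrightarrow>
        (\<forall>v. differential c f p (\<i> *s v) = \<i> *s differential c f p v))"

text \<open>\<open>second_fundamental_form N c f p u v\<close> is \<open>(\<nabla>\<^sub>u df)(v)\<close>.\<close>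

definition second_fundamental_form ::
  "('a, 'm::finite) metric_manifold \<Rightarrow> ('a, 'm) chart \<Rightarrow> (complex ^ 'n::finite \<Rightarrow> 'a) \<Rightarrow>
    complex ^ 'n \<Rightarrow> complex ^ 'n \<Rightarrow> complex ^ 'n \<Rightarrow> complex ^ 'm" where
  "second_fundamental_form N c f p u v =
     frechet_derivative (\<lambda>y. differential c f y v) (at p) u +
     christoffel N c (chart_map c (f p)) (differential c f p u) (differential c f p v)"

definition tension_field ::
  "('a, 'm::finite) metric_manifold \<Rightarrow> ('a, 'm) chart \<Rightarrow> (complex ^ 'n::finite \<Rightarrow> 'a) \<Rightarrow>
    complex ^ 'n \<Rightarrow> complex ^ 'm" where
  "tension_field N c f p = (\<Sum>b\<in>Basis. second_fundamental_form N c f p b b)"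

definition harmonic_map ::
  "('a, 'm::finite) metric_manifold \<Rightarrow> (complex ^ 'n::finite \<Rightarrow> 'a) \<Rightarrow> bool" where
  "harmonic_map N f \<longleftrightarrow>
     smooth_map N f \<and>
     (\<forall>c\<in>atlas N. \<forall>p. f p \<in> chart_dom c \<longrightarrow> tension_field N c f p = 0)"

definition energy_density_in ::
  "('a, 'm::finite) metric_manifold \<Rightarrow> ('a, 'm) chart \<Rightarrow> (complex ^ 'n::finite \<Rightarrow> 'a) \<Rightarrow>
    complex ^ 'n \<Rightarrow> real" where
  "energy_density_in N c f p =
     (let h = metric_in N c (chart_map c (f p)); df = differential c f p; e = (\<lambda>i. axis i 1)
      in 1/2 * (\<Sum>i\<in>UNIV. h (df (e i)) (df (e i)) + h (df (\<i> *s e i)) (df (\<i> *s e i))))"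

definition dbar_energy_density_in ::
  "('a, 'm::finite) metric_manifold \<Rightarrow> ('a, 'm) chart \<Rightarrow> (complex ^ 'n::finite \<Rightarrow> 'a) \<Rightarrow>
    complex ^ 'n \<Rightarrow> real" where
  "dbar_energy_density_in N c f p =
     (let h = metric_in N c (chart_map c (f p)); df = differential c f p; e = (\<lambda>i. axis i 1)
      in 1/4 * (\<Sum>i\<in>UNIV. h (df (e i)) (df (e i)) + h (df (\<i> *s e i)) (df (\<i> *s e i))
                          - 2 * h (\<i> *s df (e i)) (df (\<i> *s e i))))"

text \<open>
  The choice of the chart is immaterial, by \<open>energy_density_eq\<close> and \<open>dbar_energy_density_eq\<close> below.
\<close>

definition chart_at :: "('a, 'm::finite) metric_manifold \<Rightarrow> 'a \<Rightarrow> ('a, 'm) chart" where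
  "chart_at N q = (SOME c. c \<in> atlas N \<and> q \<in> chart_dom c)"

definition energy_density ::
  "('a, 'm::finite) metric_manifold \<Rightarrow> (complex ^ 'n::finite \<Rightarrow> 'a) \<Rightarrow> complex ^ 'n \<Rightarrow> real" where
  "energy_density N f p = energy_density_in N (chart_at N (f p)) f p"

definition dbar_energy_density ::
  "('a, 'm::finite) metric_manifold \<Rightarrow> (complex ^ 'n::finite \<Rightarrow> 'a) \<Rightarrow> complex ^ 'n \<Rightarrow> real" where
  "dbar_energy_density N f p = dbar_energy_density_in N (chart_at N (f p)) f p"


section \<open>Well-definedness\<close>

lemma christoffel_unique:
  assumes N: "kaehler_manifold N" and c: "c \<in> atlas N" and x: "x \<in> chart_img c"
  shows "\<exists>!z. \<forall>w. 2 * metric_in N c x z w =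
        frechet_derivative (\<lambda>y. metric_in N c y v w) (at x) u +
        frechet_derivative (\<lambda>y. metric_in N c y u w) (at x) v -
        frechet_derivative (\<lambda>y. metric_in N c y u v) (at x) w"
proof -
  let ?g = "metric_in N c x"
  have R: "riemannian_metric N" and op: "open (chart_img c)"
    using N c unfolding kaehler_manifold_def hermitian_metric_def complex_manifold_def chart_on_def
    by blast+
  have bl: "bilinear (metric_in N c y)" if "y \<in> chart_img c" for y
    using R c that unfolding riemannian_metric_def by blast
  have pos: "\<And>v. v \<noteq> 0 \<Longrightarrow> 0 < ?g v v"
    using R c x unfolding riemannian_metric_def by blast
  have gl: "linear (\<lambda>z. ?g z w)" and gr: "linear (\<lambda>w. ?g z w)" for z w
    using bl[OF x] unfolding bilinear_def by auto
  have diff: "(\<lambda>y. metric_in N c y a b) differentiable at x" for a b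
  proof -
    have "times_differentiable_on (Suc 0) (\<lambda>y. metric_in N c y a b) (chart_img c)"
      using R c unfolding riemannian_metric_def smooth_on_def by blast
    then show ?thesis using x by simp
  qed
  have der: "((\<lambda>y. metric_in N c y a b) has_derivative
      frechet_derivative (\<lambda>y. metric_in N c y a b) (at x)) (at x)" for a b
    using diff[of a b] frechet_derivative_works by blast
  have lin1: "linear (\<lambda>w. frechet_derivative (\<lambda>y. metric_in N c y a w) (at x) h)" for a h
  proof (rule linearI)
    fix w1 w2
    have "((\<lambda>y. metric_in N c y a w1 + metric_in N c y a w2) has_derivative
        (\<lambda>h. frechet_derivative (\<lambda>y. metric_in N c y a w1) (at x) h +
             frechet_derivative (\<lambda>y. metric_in N c y a w2) (at x) h)) (at x)"
      by (intro has_derivative_add der)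
    then have "((\<lambda>y. metric_in N c y a (w1 + w2)) has_derivative
        (\<lambda>h. frechet_derivative (\<lambda>y. metric_in N c y a w1) (at x) h +
             frechet_derivative (\<lambda>y. metric_in N c y a w2) (at x) h)) (at x)"
      by (rule has_derivative_transform_within_open[OF _ op x])
        (simp add: bilinear_radd[OF bl])
    from fun_cong[OF frechet_derivative_at[OF this], of h]
    show "frechet_derivative (\<lambda>y. metric_in N c y a (w1 + w2)) (at x) h =
        frechet_derivative (\<lambda>y. metric_in N c y a w1) (at x) h +
        frechet_derivative (\<lambda>y. metric_in N c y a w2) (at x) h" by simp
  next
    fix r w
    have "((\<lambda>y. r *\<^sub>R metric_in N c y a w) has_derivative
        (\<lambda>h. r *\<^sub>R frechet_derivative (\<lambda>y. metric_in N c y a w) (at x) h)) (at x)"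
      by (intro has_derivative_scaleR_right der)
    then have "((\<lambda>y. metric_in N c y a (r *\<^sub>R w)) has_derivative
        (\<lambda>h. r *\<^sub>R frechet_derivative (\<lambda>y. metric_in N c y a w) (at x) h)) (at x)"
      by (rule has_derivative_transform_within_open[OF _ op x])
        (simp add: bilinear_rmul[OF bl])
    from fun_cong[OF frechet_derivative_at[OF this], of h]
    show "frechet_derivative (\<lambda>y. metric_in N c y a (r *\<^sub>R w)) (at x) h =
        r *\<^sub>R frechet_derivative (\<lambda>y. metric_in N c y a w) (at x) h" by simp
  qed
  define r where "r w = frechet_derivative (\<lambda>y. metric_in N c y v w) (at x) u +
        frechet_derivative (\<lambda>y. metric_in N c y u w) (at x) v -
        frechet_derivative (\<lambda>y. metric_in N c y u v) (at x) w" for w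
  have rlin: "linear r"
    unfolding r_def
    by (intro linear_compose_add linear_compose_sub lin1 linear_frechet_derivative diff)
  have repr: "l w = (\<Sum>b\<in>Basis. l b *\<^sub>R b) \<bullet> w" if "linear l"
    for l :: "complex ^ 'b \<Rightarrow> real" and w
  proof -
    have "l w = l (\<Sum>b\<in>Basis. (w \<bullet> b) *\<^sub>R b)" by (simp add: euclidean_representation)
    also have "\<dots> = (\<Sum>b\<in>Basis. (w \<bullet> b) * l b)"
      using that by (simp add: linear_sum linear_cmul)
    finally show ?thesis by (simp add: inner_sum_left inner_sum_right inner_commute mult.commute)
  qed
  define T where "T z = (\<Sum>b\<in>Basis. ?g z b *\<^sub>R b)" for z
  have T: "?g z w = T z \<bullet> w" for z w
    unfolding T_def by (rule repr[OF gr])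
  have Tlin: "linear T"
    unfolding T_def
    by (rule linearI)
      (simp_all add: linear_add[OF gl] linear_cmul[OF gl] scaleR_add_left sum.distrib scaleR_sum_right)
  have inj: "inj T"
  proof (subst linear_injective_0[OF Tlin], intro allI impI)
    fix z assume "T z = 0"
    then have "?g z z = 0" by (simp add: T)
    then show "z = 0" using pos[of z] by force
  qed
  then have "surj T" by (simp add: linear_injective_imp_surjective[OF Tlin])
  then obtain z where z: "T z = (1/2) *\<^sub>R (\<Sum>b\<in>Basis. r b *\<^sub>R b)" by (metis surjD)
  have ex: "2 * ?g z w = r w" for w
    using repr[OF rlin, of w] by (simp add: T z)
  have "z' = z" if "\<forall>w. 2 * ?g z' w = r w" for z'
  proof -
    have "(T z' - T z) \<bullet> w = 0" for w
      using that[rule_format, of w] ex[of w] by (simp add: T inner_diff_left)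
    then have "T z' = T z" by (metis inner_eq_zero_iff right_minus_eq)
    then show ?thesis using inj by (simp add: inj_eq)
  qed
  then show ?thesis using ex unfolding r_def by blast
qed

lemma differential_change_of_chart:
  fixes f :: "complex ^ 'n::finite \<Rightarrow> 'a"
  assumes N: "complex_manifold N" and f: "smooth_map N f"
    and c: "c \<in> atlas N" "f p \<in> chart_dom c" and d: "d \<in> atlas N" "f p \<in> chart_dom d"
  shows "differential d f p v =
           frechet_derivative (transition c d) (at (chart_map c (f p))) (differential c f p v)"
    and "frechet_derivative (transition c d) (at (chart_map c (f p))) (\<i> *s w) =
           \<i> *s frechet_derivative (transition c d) (at (chart_map c (f p))) w"
proof -
  let ?x = "chart_map c (f p)"
  obtain D where D: "(transition c d has_derivative D) (at ?x)" "\<And>v. D (\<i> *s v) = \<i> *s D v"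
    using N c d unfolding complex_manifold_def complex_differentiable_at_def by blast
  have fD: "frechet_derivative (transition c d) (at ?x) = D"
    using frechet_derivative_at[OF D(1)] by simp
  have "times_differentiable_on (Suc 0) (chart_map c \<circ> f) (f -` chart_dom c)"
    using f c unfolding smooth_map_def smooth_on_def by blast
  then have "(chart_map c \<circ> f) differentiable at p" using c by simp
  then have der: "((chart_map c \<circ> f) has_derivative differential c f p) (at p)"
    unfolding differential_def using frechet_derivative_works by (metis (no_types) eta_contract_eq)
  have comp: "((transition c d \<circ> (chart_map c \<circ> f)) has_derivative (D \<circ> differential c f p)) (at p)"
    by (rule diff_chain_at[OF der]) (simp add: D(1))
  have chart: "chart_on (points N) c" using N c unfolding complex_manifold_def by blast
  have "chart_dom c \<subseteq> topspace (points N)"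
    using chart unfolding chart_on_def by (simp add: openin_subset)
  then have inj: "inj_on (chart_map c) (chart_dom c)"
    using chart homeomorphic_imp_injective_map unfolding chart_on_def
    by (fastforce simp: Int_absorb1)
  have op: "open (f -` chart_dom c)"
    using f chart unfolding smooth_map_def chart_on_def continuous_map_def vimage_def by simp
  have "((chart_map d \<circ> f) has_derivative (D \<circ> differential c f p)) (at p)"
    by (rule has_derivative_transform_within_open[OF comp op])
      (use c inj in \<open>auto simp: transition_def\<close>)
  from fun_cong[OF frechet_derivative_at[OF this], of v]
  show "differential d f p v = frechet_derivative (transition c d) (at ?x) (differential c f p v)"
    unfolding fD differential_def by simp
  show "frechet_derivative (transition c d) (at ?x) (\<i> *s w) =
      \<i> *s frechet_derivative (transition c d) (at ?x) w"
    unfolding fD by (rule D(2))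
qed

lemma energy_density_in_eq:
  fixes f :: "complex ^ 'n::finite \<Rightarrow> 'a"
  assumes N: "kaehler_manifold N" and f: "smooth_map N f"
    and c: "c \<in> atlas N" "f p \<in> chart_dom c" and d: "d \<in> atlas N" "f p \<in> chart_dom d"
  shows "energy_density_in N c f p = energy_density_in N d f p"
    and "dbar_energy_density_in N c f p = dbar_energy_density_in N d f p"
proof -
  let ?T = "frechet_derivative (transition c d) (at (chart_map c (f p)))"
  have cm: "complex_manifold N" and R: "riemannian_metric N"
    using N unfolding kaehler_manifold_def hermitian_metric_def by blast+
  note ch = differential_change_of_chart[OF cm f c d]
  have g: "metric_in N c (chart_map c (f p)) v w = metric_in N d (chart_map d (f p)) (?T v) (?T w)" for v w
    using R c d unfolding riemannian_metric_def by blast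
  show "energy_density_in N c f p = energy_density_in N d f p"
    and "dbar_energy_density_in N c f p = dbar_energy_density_in N d f p"
    by (simp_all add: energy_density_in_def dbar_energy_density_in_def Let_def g ch)
qed

lemma chart_at:
  assumes "complex_manifold N" "smooth_map N f"
  shows "chart_at N (f p) \<in> atlas N" "f p \<in> chart_dom (chart_at N (f p))"
proof -
  have "f p \<in> topspace (points N)"
    using assms(2) unfolding smooth_map_def continuous_map_def by auto
  then have "\<exists>c. c \<in> atlas N \<and> f p \<in> chart_dom c"
    using assms(1) unfolding complex_manifold_def by blast
  from someI_ex[OF this]
  show "chart_at N (f p) \<in> atlas N" "f p \<in> chart_dom (chart_at N (f p))"
    unfolding chart_at_def by blast+
qed

lemma
  assumes N: "kaehler_manifold N" and f: "smooth_map N f"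
    and c: "c \<in> atlas N" "f p \<in> chart_dom c"
  shows energy_density_eq: "energy_density N f p = energy_density_in N c f p"
    and dbar_energy_density_eq: "dbar_energy_density N f p = dbar_energy_density_in N c f p"
proof -
  have "complex_manifold N" using N unfolding kaehler_manifold_def by blast
  note * = chart_at[OF this f, of p]
  show "energy_density N f p = energy_density_in N c f p"
    and "dbar_energy_density N f p = dbar_energy_density_in N c f p"
    unfolding energy_density_def dbar_energy_density_def
    using energy_density_in_eq[OF N f * c] by blast+
qed

end

theory Submission
  imports Defs
begin

text \<open>
  With \<open>\<sigma>\<^sub>a = 1/2 (f\<^sub>* a + J' f\<^sub>* J a)\<close>, the stress-energy tensor
  \<open>T\<^sub>a\<^sub>b = \<delta>\<^sub>a\<^sub>b e''(f) - \<langle>\<sigma>\<^sub>a, f\<^sub>* b\<rangle>\<close> of the \<open>\<partial>\<close>-bar energy is divergence free when \<open>f\<close> is harmonic,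
  because the Levi-Civita connection of a Kaehler manifold commutes with \<open>J'\<close>. Its trace is
  \<open>(2 n - 2) e''(f) \<ge> 0\<close>, and \<open>|T\<^sub>a\<^sub>b| \<le> 3 sqrt (e(f) e''(f)) = O(R powr - (2 n + \<alpha> / 2))\<close>. Since
  \<open>\<partial>\<^sub>a (x\<^sub>b T\<^sub>a\<^sub>b) = T\<^sub>a\<^sub>a\<close>, the integral of the trace over a ball of radius \<open>R\<close> is a flux through the sphere of
  order \<open>R powr - (\<alpha> / 2)\<close>. It tends to \<open>0\<close>, hence \<open>e''(f) = 0\<close>.
\<close>

section \<open>Symmetry of second derivatives\<close>

text \<open>Origin of \<open>T\<close>: \<open>e''\<close> is half the sum of the squared lengths of
  the \<open>\<sigma>\<close> components, a quadratic form in the differential whose gradient is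
  \<open>\<sigma>\<close>, because taking the antilinear part is an orthogonal projection. So
  \<open>T\<close> is the canonical energy-momentum tensor of this Lagrangian, the conserved
  quantity that belongs to translations of the domain. Its conservation law involves second
  derivatives of the map and first derivatives of the metric only; the curvature of
  \<open>N\<close>, about which nothing is known, does not enter as it would in a Bochner formula.
  Harmonicity concerns \<open>e\<close> rather than \<open>e''\<close>. The bridge is that the
  second fundamental form is symmetric while the complex structure of the domain is skew, so their
  contraction vanishes. \<open>N\<close> is given by charts only, but the components of
  \<open>T\<close> are real functions on the whole domain that do not depend on the chart. Hence the
  geometry can stay inside one chart, and the integration sees scalar functions on a Euclidean
  space.\<close>

lemma second_difference_mean_value:
  fixes g :: "'e::real_normed_vector \<Rightarrow> real"
  assumes g: "\<And>x. x \<in> ball p r \<Longrightarrow> (g has_derivative g' x) (at x)"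
    and g': "\<And>x. x \<in> ball p r \<Longrightarrow> ((\<lambda>y. g' y u) has_derivative g'' x) (at x)"
    and t: "0 < t" "t * (norm u + norm v) < r"
  obtains y where "y \<in> ball p r"
    "g (p + t *\<^sub>R u + t *\<^sub>R v) - g (p + t *\<^sub>R u) - g (p + t *\<^sub>R v) + g p = t\<^sup>2 * g'' y v"
proof -
  have in_ball: "p + a *\<^sub>R u + b *\<^sub>R v \<in> ball p r" if "0 \<le> a" "a \<le> t" "0 \<le> b" "b \<le> t" for a b
  proof -
    have "norm (a *\<^sub>R u + b *\<^sub>R v) \<le> norm (a *\<^sub>R u) + norm (b *\<^sub>R v)" by (rule norm_triangle_ineq)
    also have "\<dots> = a * norm u + b * norm v" using that by simp
    also have "\<dots> \<le> t * norm u + t * norm v" using that by (intro add_mono mult_right_mono) auto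
    also have "\<dots> < r" using t(2) by (simp add: algebra_simps)
    finally have "norm (a *\<^sub>R u + b *\<^sub>R v) < r" .
    moreover have "dist p (p + a *\<^sub>R u + b *\<^sub>R v) = norm (a *\<^sub>R u + b *\<^sub>R v)"
      by (metis add.assoc add_diff_cancel_left' dist_commute dist_norm)
    ultimately show ?thesis by simp
  qed
  have line: "((\<lambda>s. g (p + s *\<^sub>R u + b *\<^sub>R v)) has_real_derivative g' (p + a *\<^sub>R u + b *\<^sub>R v) u) (at a)"
    if "0 \<le> a" "a \<le> t" "0 \<le> b" "b \<le> t" for a b
  proof -
    let ?x = "p + a *\<^sub>R u + b *\<^sub>R v"
    have l: "linear (g' ?x)" using g[OF in_ball[OF that]] by (rule has_derivative_linear)
    have "((\<lambda>s. p + s *\<^sub>R u + b *\<^sub>R v) has_derivative (\<lambda>s. s *\<^sub>R u)) (at a)"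
      by (auto intro!: derivative_eq_intros)
    from diff_chain_at[OF this g[OF in_ball[OF that]]]
    show ?thesis using l by (simp add: has_field_derivative_def o_def linear_cmul mult.commute[of _ "g' ?x u"])
  qed
  \<comment> \<open>Mean value theorem along \<open>u\<close>, for the increment of \<open>g\<close>
    over \<open>t *\<^sub>R v\<close>; a second one along \<open>v\<close> follows. The summands
    with factor 0 let both ends match \<open>line\<close>.\<close>
  have "\<exists>\<xi>>0. \<xi> < t \<and> (g (p + t *\<^sub>R u + t *\<^sub>R v) - g (p + t *\<^sub>R u + 0 *\<^sub>R v))
      - (g (p + 0 *\<^sub>R u + t *\<^sub>R v) - g (p + 0 *\<^sub>R u + 0 *\<^sub>R v)) =
     (t - 0) * (g' (p + \<xi> *\<^sub>R u + t *\<^sub>R v) u - g' (p + \<xi> *\<^sub>R u + 0 *\<^sub>R v) u)"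
    by (rule MVT2[OF t(1)], rule DERIV_diff; rule line) (use t in auto)
  then obtain \<xi> where \<xi>: "0 < \<xi>" "\<xi> < t" and
    1: "g (p + t *\<^sub>R u + t *\<^sub>R v) - g (p + t *\<^sub>R u) - g (p + t *\<^sub>R v) + g p =
        t * (g' (p + \<xi> *\<^sub>R u + t *\<^sub>R v) u - g' (p + \<xi> *\<^sub>R u + 0 *\<^sub>R v) u)"
    by auto
  have line2: "((\<lambda>s. g' (p + \<xi> *\<^sub>R u + s *\<^sub>R v) u) has_real_derivative g'' (p + \<xi> *\<^sub>R u + b *\<^sub>R v) v) (at b)"
    if "0 \<le> b" "b \<le> t" for b
  proof -
    let ?x = "p + \<xi> *\<^sub>R u + b *\<^sub>R v"
    have x: "?x \<in> ball p r" using \<xi> that by (intro in_ball) auto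
    have l: "linear (g'' ?x)" using g'[OF x] by (rule has_derivative_linear)
    have "((\<lambda>s. p + \<xi> *\<^sub>R u + s *\<^sub>R v) has_derivative (\<lambda>s. s *\<^sub>R v)) (at b)"
      by (auto intro!: derivative_eq_intros)
    from diff_chain_at[OF this g'[OF x]]
    show ?thesis using l by (simp add: has_field_derivative_def o_def linear_cmul mult.commute[of _ "g'' ?x v"])
  qed
  have "\<exists>\<eta>>0. \<eta> < t \<and> g' (p + \<xi> *\<^sub>R u + t *\<^sub>R v) u - g' (p + \<xi> *\<^sub>R u + 0 *\<^sub>R v) u =
     (t - 0) * g'' (p + \<xi> *\<^sub>R u + \<eta> *\<^sub>R v) v"
    by (rule MVT2[OF t(1) line2])
  then obtain \<eta> where \<eta>: "0 < \<eta>" "\<eta> < t" and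
    2: "g' (p + \<xi> *\<^sub>R u + t *\<^sub>R v) u - g' (p + \<xi> *\<^sub>R u + 0 *\<^sub>R v) u = t * g'' (p + \<xi> *\<^sub>R u + \<eta> *\<^sub>R v) v"
    by auto
  show thesis
    by (rule that[of "p + \<xi> *\<^sub>R u + \<eta> *\<^sub>R v"])
      (use in_ball \<xi> \<eta> 1 2 in \<open>auto simp: power2_eq_square\<close>)
qed

text \<open>The second difference of \<open>second_difference_mean_value\<close> is symmetric in
  \<open>u\<close> and \<open>v\<close>, so some \<open>gu y v\<close> equals some
  \<open>gv z u\<close> with \<open>y\<close> and \<open>z\<close> as close to \<open>p\<close> as
  desired; continuity then excludes a gap at \<open>p\<close>.\<close>

lemma second_derivative_commute_real:
  fixes g :: "'e::real_normed_vector \<Rightarrow> real"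
  assumes S: "open S" "p \<in> S"
    and g: "\<And>x. x \<in> S \<Longrightarrow> (g has_derivative g' x) (at x)"
    and gu: "\<And>x. x \<in> S \<Longrightarrow> ((\<lambda>y. g' y u) has_derivative gu x) (at x)"
    and gv: "\<And>x. x \<in> S \<Longrightarrow> ((\<lambda>y. g' y v) has_derivative gv x) (at x)"
    and cont: "continuous_on S (\<lambda>x. gu x v)" "continuous_on S (\<lambda>x. gv x u)"
  shows "gu p v = gv p u"
proof (rule ccontr)
  assume ne: "gu p v \<noteq> gv p u"
  let ?e = "\<bar>gu p v - gv p u\<bar> / 2"
  have e: "0 < ?e" using ne by simp
  obtain r0 where r0: "r0 > 0" "ball p r0 \<subseteq> S" using S openE by blast
  have "isCont (\<lambda>x. gu x v) p" "isCont (\<lambda>x. gv x u) p"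
    using cont S continuous_on_eq_continuous_at by blast+
  then have "\<exists>d>0. \<forall>x. dist x p < d \<longrightarrow> \<bar>gu x v - gu p v\<bar> < ?e"
    and "\<exists>d>0. \<forall>x. dist x p < d \<longrightarrow> \<bar>gv x u - gv p u\<bar> < ?e"
    using e unfolding continuous_at_eps_delta dist_real_def by blast+
  then obtain r1 r2 where r1: "r1 > 0" "\<And>x. dist x p < r1 \<Longrightarrow> \<bar>gu x v - gu p v\<bar> < ?e"
    and r2: "r2 > 0" "\<And>x. dist x p < r2 \<Longrightarrow> \<bar>gv x u - gv p u\<bar> < ?e"
    by blast
  define r where "r = min r0 (min r1 r2)"
  have r: "r > 0" "ball p r \<subseteq> S" using r0 r1 r2 by (auto simp: r_def)
  \<comment> \<open>The \<open>+ 1\<close> keeps the denominator positive even for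
    \<open>u = v = 0\<close> and puts the parallelogram strictly inside the ball.\<close>
  define t where "t = r / (norm u + norm v + 1)"
  have pos: "0 < norm u + norm v + 1" by (intro add_nonneg_pos) auto
  then have t: "0 < t" using r by (simp add: t_def)
  have "t * (norm u + norm v) < t * (norm u + norm v + 1)" using t by simp
  also have "\<dots> = r" using pos by (simp add: t_def)
  finally have t': "t * (norm u + norm v) < r" "t * (norm v + norm u) < r" by (simp_all add: add.commute)
  obtain y where y: "y \<in> ball p r"
    "g (p + t *\<^sub>R u + t *\<^sub>R v) - g (p + t *\<^sub>R u) - g (p + t *\<^sub>R v) + g p = t\<^sup>2 * gu y v"
    by (rule second_difference_mean_value[of p r g g' u gu, OF _ _ t t'(1)]) (use g gu r in auto)
  obtain z where z: "z \<in> ball p r"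
    "g (p + t *\<^sub>R v + t *\<^sub>R u) - g (p + t *\<^sub>R v) - g (p + t *\<^sub>R u) + g p = t\<^sup>2 * gv z u"
    by (rule second_difference_mean_value[of p r g g' v gv, OF _ _ t t'(2)]) (use g gv r in auto)
  have "t\<^sup>2 * gu y v = t\<^sup>2 * gv z u" using y(2) z(2) by (simp add: algebra_simps)
  then have eq: "gu y v = gv z u" using t by simp
  have "dist y p < r1" "dist z p < r2"
    using y(1) z(1) by (auto simp: r_def dist_commute)
  then have "\<bar>gu y v - gu p v\<bar> + \<bar>gv z u - gv p u\<bar> < ?e + ?e"
    by (intro add_strict_mono r1(2) r2(2))
  moreover have "\<bar>gu p v - gv p u\<bar> \<le> \<bar>gu y v - gu p v\<bar> + \<bar>gv z u - gv p u\<bar>"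
    unfolding eq by linarith
  ultimately show False by simp
qed

lemma smooth_on_derivative: "smooth_on F S \<Longrightarrow> smooth_on (\<lambda>x. frechet_derivative F (at x) v) S"
  unfolding smooth_on_def using times_differentiable_on.simps(2) by blast

lemma smooth_on_differentiable:
  assumes "smooth_on F S" "x \<in> S"
  shows "(F has_derivative frechet_derivative F (at x)) (at x)"
proof -
  have "times_differentiable_on (Suc 0) F S" using assms(1) unfolding smooth_on_def by blast
  then have "F differentiable at x" using assms(2) by simp
  then show ?thesis by (rule frechet_derivative_works[THEN iffD1])
qed

lemma smooth_on_continuous:
  assumes "smooth_on F S"
  shows "continuous_on S F"
proof -
  have "times_differentiable_on 0 F S" using assms unfolding smooth_on_def by blast
  then show ?thesis by simp
qed

lemma smooth_on_second_derivative_commute: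
  fixes F :: "'e::euclidean_space \<Rightarrow> 'b::euclidean_space"
  assumes F: "smooth_on F S" and S: "open S" "p \<in> S"
  shows "frechet_derivative (\<lambda>y. frechet_derivative F (at y) u) (at p) v =
         frechet_derivative (\<lambda>y. frechet_derivative F (at y) v) (at p) u"
proof (rule euclidean_eqI)
  fix b :: 'b assume "b \<in> Basis"
  let ?D = "\<lambda>w x. frechet_derivative (\<lambda>y. frechet_derivative F (at y) w) (at x)"
  note sm = smooth_on_derivative[OF F]
  show "?D u p v \<bullet> b = ?D v p u \<bullet> b"
  proof (rule second_derivative_commute_real[OF S])
    show "((\<lambda>x. F x \<bullet> b) has_derivative (\<lambda>w. frechet_derivative F (at x) w \<bullet> b)) (at x)"
      if "x \<in> S" for x
      by (intro has_derivative_inner_left smooth_on_differentiable[OF F] that)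
    show "((\<lambda>x. frechet_derivative F (at x) u \<bullet> b) has_derivative (\<lambda>w. ?D u x w \<bullet> b)) (at x)"
      and "((\<lambda>x. frechet_derivative F (at x) v \<bullet> b) has_derivative (\<lambda>w. ?D v x w \<bullet> b)) (at x)"
      if "x \<in> S" for x
      by (rule has_derivative_inner_left[OF smooth_on_differentiable[OF sm that]])+
    show "continuous_on S (\<lambda>x. ?D u x v \<bullet> b)" "continuous_on S (\<lambda>x. ?D v x u \<bullet> b)"
      by (intro continuous_on_inner smooth_on_continuous smooth_on_derivative F continuous_on_const)+
  qed
qed

section \<open>Divergence-free tensor fields with fast decay\<close>

lemma integrable_compact_support:
  fixes u :: "'e::euclidean_space \<Rightarrow> real"
  assumes "continuous_on UNIV u" "\<And>x. R < norm x \<Longrightarrow> u x = 0"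
  shows "integrable lborel u"
proof -
  have "integrable lborel (\<lambda>x. indicator (cball 0 R) x *\<^sub>R u x)"
    by (rule borel_integrable_compact) (use assms(1) in \<open>auto intro: continuous_on_subset\<close>)
  moreover have "(\<lambda>x. indicator (cball 0 R) x *\<^sub>R u x) = u"
    using assms(2) by (auto simp: indicator_def fun_eq_iff not_le)
  ultimately show ?thesis by simp
qed

lemma lborel_integral_translate:
  fixes u :: "'e::euclidean_space \<Rightarrow> real"
  assumes "u \<in> borel_measurable borel"
  shows "(\<integral>x. u (c + x) \<partial>lborel) = (\<integral>x. u x \<partial>lborel)"
proof -
  have "(\<integral>x. u x \<partial>lborel) = (\<integral>x. u x \<partial>distr lborel borel ((+) c))"
    by (simp add: lborel_distr_plus)
  also have "\<dots> = (\<integral>x. u (c + x) \<partial>lborel)"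
    by (rule integral_distr) (use assms in auto)
  finally show ?thesis by simp
qed

text \<open>Difference quotients of \<open>u\<close> along \<open>e\<close> integrate to 0 by
  translation invariance of Lebesgue measure, and dominated convergence passes to the derivative.
  This replaces the divergence theorem on balls.\<close>

lemma integral_directional_derivative_eq_0:
  fixes u :: "'e::euclidean_space \<Rightarrow> real"
  assumes u: "\<And>x. (u has_derivative u' x) (at x)"
    and cont: "continuous_on UNIV (\<lambda>x. u' x e)"
    and supp: "\<And>x. R < norm x \<Longrightarrow> u x = 0"
  shows "integrable lborel (\<lambda>x. u' x e)" "(\<integral>x. u' x e \<partial>lborel) = 0"
proof -
  let ?R = "R + norm e"
  have line: "((\<lambda>s. u (x + s *\<^sub>R e)) has_real_derivative u' (x + t *\<^sub>R e) e) (at t)" for x t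
  proof -
    have l: "linear (u' (x + t *\<^sub>R e))" using u by (rule has_derivative_linear)
    have "((\<lambda>s. x + s *\<^sub>R e) has_derivative (\<lambda>s. s *\<^sub>R e)) (at t)"
      by (auto intro!: derivative_eq_intros)
    from diff_chain_at[OF this u]
    show ?thesis using l
      by (simp add: has_field_derivative_def o_def linear_cmul mult.commute[of _ "u' (x + t *\<^sub>R e) e"])
  qed
  have cu: "continuous_on UNIV u"
    by (intro continuous_at_imp_continuous_on ballI has_derivative_continuous[OF u])
  have iu: "integrable lborel u" by (rule integrable_compact_support[OF cu supp])
  \<comment> \<open>The step lengths are nonzero and at most 1, so all quotients vanish outside the
    one ball of radius \<open>R + norm e\<close>.\<close>
  define s where "s n x = real (Suc n) * (u ((1 / real (Suc n)) *\<^sub>R e + x) - u x)" for n x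
  have lim: "(\<lambda>n. s n x) \<longlonglongrightarrow> u' x e" for x
  proof -
    have "((\<lambda>t. (u (x + (0 + t) *\<^sub>R e) - u (x + 0 *\<^sub>R e)) / t) \<longlongrightarrow> u' (x + 0 *\<^sub>R e) e) (at 0)"
      using line[of x 0] unfolding DERIV_def by simp
    then have "((\<lambda>t. (u (x + t *\<^sub>R e) - u x) / t) \<longlongrightarrow> u' x e) (at 0)" by simp
    moreover have "filterlim (\<lambda>n. 1 / real (Suc n)) (at 0) sequentially"
      unfolding filterlim_at using LIMSEQ_inverse_real_of_nat by (auto simp: inverse_eq_divide)
    ultimately have "(\<lambda>n. (u (x + (1 / real (Suc n)) *\<^sub>R e) - u x) / (1 / real (Suc n))) \<longlonglongrightarrow> u' x e"
      by (rule filterlim_compose[where g = "\<lambda>t. (u (x + t *\<^sub>R e) - u x) / t"])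
    then show ?thesis by (simp add: s_def add.commute[of x] mult.commute)
  qed
  have "compact ((\<lambda>x. u' x e) ` cball 0 ?R)"
    by (rule compact_continuous_image[OF continuous_on_subset[OF cont]]) auto
  then obtain B where B: "\<And>x. norm x \<le> ?R \<Longrightarrow> \<bar>u' x e\<bar> \<le> B"
    by (force dest!: compact_imp_bounded simp: bounded_iff)
  \<comment> \<open>On the ball, \<open>s n x\<close> is a derivative at an intermediate point, by
    the mean value theorem. That point may leave the ball, but there \<open>u\<close> vanishes on an
    open set and so does its derivative. \<open>max B 0\<close> guards against a negative
    \<open>B\<close>, possible if the ball is empty.\<close>
  have bound: "norm (s n x) \<le> indicator (cball 0 ?R) x * max B 0" for n x
  proof (cases "norm x \<le> ?R")
    case False
    let ?t = "1 / real (Suc n)"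
    have "norm (?t *\<^sub>R e) \<le> norm e" using divide_left_mono[of 1 "real (Suc n)" "norm e"] by simp
    moreover have "norm x \<le> norm (?t *\<^sub>R e + x) + norm (?t *\<^sub>R e)"
      by (metis add.commute norm_add_leD order_refl)
    ultimately have "R < norm (?t *\<^sub>R e + x)" "R < norm x" using False norm_ge_zero[of e] by linarith+
    then have "u (?t *\<^sub>R e + x) = 0" "u x = 0" by (auto intro!: supp)
    then show ?thesis by (simp add: s_def indicator_def)
  next
    case True
    let ?t = "1 / real (Suc n)"
    have "\<exists>z>0. z < ?t \<and> u (x + ?t *\<^sub>R e) - u (x + 0 *\<^sub>R e) = (?t - 0) * u' (x + z *\<^sub>R e) e"
      by (rule MVT2) (use line in auto)
    then obtain z where z: "u (x + ?t *\<^sub>R e) - u x = ?t * u' (x + z *\<^sub>R e) e" by auto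
    then have "s n x = u' (x + z *\<^sub>R e) e" by (simp add: s_def add.commute)
    moreover have "\<bar>u' y e\<bar> \<le> max B 0" for y
    proof (cases "norm y \<le> ?R")
      case True then show ?thesis using B[of y] by simp
    next
      case False
      have "open {y. R < norm y}" by (intro open_Collect_less continuous_intros)
      moreover have "y \<in> {y. R < norm y}" using False norm_ge_zero[of e] by (simp, linarith)
      ultimately have "((\<lambda>_. 0) has_derivative u' y) (at y)"
        by (rule has_derivative_transform_within_open[OF u]) (use supp in auto)
      from frechet_derivative_at[OF this] have "u' y = (\<lambda>_. 0)" by simp
      then show ?thesis by simp
    qed
    ultimately show ?thesis using True by (simp add: indicator_def)
  qed
  have iw: "integrable lborel (\<lambda>x::'e. indicator (cball 0 ?R) x * max B 0)"
    using emeasure_lborel_cball_finite[of "0::'e" ?R]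
    by (intro integrable_mult_left integrable_real_indicator) auto
  have um: "u \<in> borel_measurable borel" using cu by (rule borel_measurable_continuous_onI)
  have sm: "s n \<in> borel_measurable lborel" for n
    unfolding s_def using um by measurable
  have dm: "(\<lambda>x. u' x e) \<in> borel_measurable lborel"
    using borel_measurable_continuous_onI[OF cont] by simp
  show "integrable lborel (\<lambda>x. u' x e)"
    by (rule integrable_dominated_convergence[where s = s, OF dm sm iw]) (use lim bound in auto)
  have "(\<lambda>n. \<integral>x. s n x \<partial>lborel) \<longlonglongrightarrow> (\<integral>x. u' x e \<partial>lborel)"
    by (rule integral_dominated_convergence[where s = s, OF dm sm iw]) (use lim bound in auto)
  moreover have "(\<integral>x. s n x \<partial>lborel) = 0" for n
  proof -
    let ?c = "(1 / real (Suc n)) *\<^sub>R e"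
    have "integrable lborel (\<lambda>x. u (?c + x))"
      using iu um integrable_distr_eq[of "(+) ?c" lborel borel u] by (simp add: lborel_distr_plus)
    then show ?thesis
      unfolding s_def using iu lborel_integral_translate[OF um, of ?c] by simp
  qed
  ultimately show "(\<integral>x. u' x e \<partial>lborel) = 0" by (simp add: LIMSEQ_const_iff)
qed

section \<open>A C^1 cutoff function\<close>

lemma has_real_derivative_pos_part_squared:
  "((\<lambda>s. (max 0 s)\<^sup>2) has_real_derivative 2 * max 0 s) (at s)" for s :: real
proof (cases s "0::real" rule: linorder_cases)
  case greater
  have "((\<lambda>s. s\<^sup>2) has_real_derivative 2 * s) (at s)" by (auto intro!: derivative_eq_intros)
  then have "((\<lambda>s. (max 0 s)\<^sup>2) has_real_derivative 2 * s) (at s)"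
    by (rule has_field_derivative_transform_within_open[where S = "{0<..}"]) (use greater in auto)
  then show ?thesis using greater by simp
next
  case less
  have "((\<lambda>s. 0) has_real_derivative 0) (at s)" by simp
  then have "((\<lambda>s. (max 0 s)\<^sup>2) has_real_derivative 0) (at s)"
    by (rule has_field_derivative_transform_within_open[where S = "{..<0}"]) (use less in auto)
  then show ?thesis using less by simp
next
  case equal
  \<comment> \<open>At the corner, squaring saves differentiability: the difference quotient is at
    most \<open>\<bar>h\<bar>\<close> in absolute value.\<close>
  have "((\<lambda>h::real. (max 0 h)\<^sup>2 / h) \<longlongrightarrow> 0) (at 0)"
  proof (rule Lim_null_comparison[where g = "\<lambda>h. \<bar>h\<bar>"])
    show "\<forall>\<^sub>F h::real in at 0. norm ((max 0 h)\<^sup>2 / h) \<le> \<bar>h\<bar>"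
      by (rule always_eventually) (auto simp: max_def power2_eq_square)
    show "((\<lambda>h::real. \<bar>h\<bar>) \<longlongrightarrow> 0) (at 0)"
      using tendsto_rabs[OF tendsto_ident_at[of "0::real" UNIV]] by simp
  qed
  then show ?thesis using equal by (simp add: DERIV_def)
qed

text \<open>A piecewise polynomial descent from 1 at \<open>s = 1\<close> to 0 at
  \<open>s = 2\<close>, using the squared positive part twice. It is C^1, which is the regularity
  that \<open>integral_directional_derivative_eq_0\<close> asks for.\<close>

definition cutoff :: "real \<Rightarrow> real" where
  "cutoff s = (max 0 (1 - (max 0 (s - 1))\<^sup>2))\<^sup>2"

definition cutoff' :: "real \<Rightarrow> real" where
  "cutoff' s = - (4 * max 0 (1 - (max 0 (s - 1))\<^sup>2) * max 0 (s - 1))"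

lemma cutoff_has_derivative: "(cutoff has_real_derivative cutoff' s) (at s)"
proof -
  let ?q = "\<lambda>s::real. (max 0 s)\<^sup>2"
  have "((\<lambda>s. ?q (s - 1)) has_real_derivative 2 * max 0 (s - 1) * 1) (at s)"
    by (rule DERIV_chain2[OF has_real_derivative_pos_part_squared]) (auto intro!: derivative_eq_intros)
  from DERIV_diff[OF DERIV_const[of 1] this]
  have "((\<lambda>s. 1 - ?q (s - 1)) has_real_derivative - (2 * max 0 (s - 1))) (at s)" by simp
  from DERIV_chain2[OF has_real_derivative_pos_part_squared this]
  show ?thesis unfolding cutoff_def cutoff'_def by (simp add: mult_ac)
qed

lemma cutoff'_continuous: "continuous_on S cutoff'"
  unfolding cutoff'_def by (intro continuous_intros)

lemma cutoff_eq_1: "s \<le> 1 \<Longrightarrow> cutoff s = 1"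
  by (simp add: cutoff_def)

lemma cutoff_nonneg: "0 \<le> cutoff s"
  by (simp add: cutoff_def)

lemma cutoff_eq_0: "2 \<le> s \<Longrightarrow> cutoff s = 0"
  using power_mono[of 1 "s - 1" 2] by (simp add: cutoff_def)

lemma cutoff'_eq_0: "s \<le> 1 \<or> 2 \<le> s \<Longrightarrow> cutoff' s = 0"
  using power_mono[of 1 "s - 1" 2] by (auto simp: cutoff'_def)

lemma cutoff'_bound: "\<bar>cutoff' s\<bar> \<le> 4"
proof (cases "s \<le> 1 \<or> 2 \<le> s")
  case False
  have "max 0 (1 - (max 0 (s - 1))\<^sup>2) * max 0 (s - 1) \<le> 1 * 1"
    by (rule mult_mono) (use False in auto)
  then show ?thesis by (simp add: cutoff'_def)
qed (simp add: cutoff'_eq_0)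

text \<open>
  Pair the vector field with components \<open>\<Sum>b. (x \<bullet> b) T a b x\<close>, whose divergence is the trace of \<open>T\<close>,
  with cutoff functions of radius \<open>R\<close>: the error term is supported in the shell between \<open>R\<close> and
  \<open>2 * R\<close>, and is \<open>O(R powr - \<beta>)\<close>.
\<close>

lemma divergence_free_decay_trace_eq_0:
  fixes T :: "'e::euclidean_space \<Rightarrow> 'e \<Rightarrow> 'e \<Rightarrow> real" and \<beta> :: real
  assumes T: "\<And>a b x. a \<in> Basis \<Longrightarrow> b \<in> Basis \<Longrightarrow> (T a b has_derivative T' a b x) (at x)"
    and cont: "\<And>a b. a \<in> Basis \<Longrightarrow> b \<in> Basis \<Longrightarrow> continuous_on UNIV (\<lambda>x. T' a b x a)"
    and div: "\<And>b x. b \<in> Basis \<Longrightarrow> (\<Sum>a\<in>Basis. T' a b x a) = 0"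
    and nonneg: "\<And>x. 0 \<le> (\<Sum>a\<in>Basis. T a a x)"
    and decay: "\<And>a b x. a \<in> Basis \<Longrightarrow> b \<in> Basis \<Longrightarrow> R\<^sub>0 \<le> norm x \<Longrightarrow>
          \<bar>T a b x\<bar> \<le> C * norm x powr - (real DIM('e) + \<beta>)"
    and pos: "0 < \<beta>" "0 < R\<^sub>0" "0 \<le> C"
  shows "(\<Sum>a\<in>Basis. T a a x) = 0"
proof (rule ccontr)
  let ?m = "real DIM('e)"
  define tr where "tr x = (\<Sum>a\<in>Basis. T a a x)" for x
  define V where "V a x = (\<Sum>b\<in>Basis. (x \<bullet> b) * T a b x)" for a x
  have contT: "continuous_on UNIV (T a b)" if "a \<in> Basis" "b \<in> Basis" for a b
    by (intro continuous_at_imp_continuous_on ballI has_derivative_continuous[OF T[OF that]])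
  have cont_tr: "continuous_on UNIV tr"
    unfolding tr_def by (intro continuous_intros contT)
  \<comment> \<open>The first 4 bounds \<open>(norm y)\<^sup>2 / R\<^sup>2\<close> on the shell; 8
    is 4 from \<open>cutoff'_bound\<close> times 2 from differentiating
    \<open>y \<bullet> y\<close>; \<open>?m\<^sup>2\<close> counts the pairs \<open>a\<close>,
    \<open>b\<close>; the rest is the volume of a ball of radius \<open>2 * R\<close> without its
    factor \<open>R powr ?m\<close>.\<close>
  define K where "K = 4 * ?m\<^sup>2 * (8 * C) * measure lborel (cball (0::'e) 1) * 2 powr ?m"
  assume "(\<Sum>a\<in>Basis. T a a x) \<noteq> 0"
  then have trx: "tr x > 0" using nonneg[of x] by (simp add: tr_def)
  have "isCont tr x" using cont_tr by (simp add: continuous_on_eq_continuous_at)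
  then obtain d where d: "d > 0" "\<And>y. dist y x < d \<Longrightarrow> \<bar>tr y - tr x\<bar> < tr x / 2"
    using trx unfolding continuous_at_eps_delta dist_real_def by (metis half_gt_zero)
  \<comment> \<open>On \<open>ball x d\<close> the trace exceeds half its value at \<open>x\<close>,
    and it is nonnegative elsewhere, so \<open>M\<close> bounds its integral over every large ball
    from below.\<close>
  define M where "M = measure lborel (ball x d) * (tr x / 2)"
  have M: "M > 0"
    unfolding M_def using d(1) trx content_ball_pos[of d x] by (simp add: measure_completion)
  have est: "M \<le> K * R powr - \<beta>" if R: "R\<^sub>0 \<le> R" "norm x + d \<le> R" for R
  proof -
    have Rpos: "0 < R" using pos R by simp
    \<comment> \<open>The squared norm keeps \<open>\<phi>\<close> differentiable at the origin. It
      vanishes from radius \<open>sqrt 2 * R\<close> on; \<open>2 * R\<close> is a rounder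
      bound.\<close>
    define \<phi> where "\<phi> y = cutoff ((y \<bullet> y) / R\<^sup>2)" for y :: 'e
    define \<phi>' where "\<phi>' y v = cutoff' ((y \<bullet> y) / R\<^sup>2) * (2 * (y \<bullet> v) / R\<^sup>2)" for y v :: 'e
    have d\<phi>: "(\<phi> has_derivative \<phi>' y) (at y)" for y
    proof -
      have "((\<lambda>y::'e. (1 / R\<^sup>2) *\<^sub>R (y \<bullet> y)) has_derivative (\<lambda>v. (1 / R\<^sup>2) *\<^sub>R (y \<bullet> v + v \<bullet> y))) (at y)"
        by (intro has_derivative_scaleR_right has_derivative_inner has_derivative_ident)
      then have "((\<lambda>y::'e. (y \<bullet> y) / R\<^sup>2) has_derivative (\<lambda>v. 2 * (y \<bullet> v) / R\<^sup>2)) (at y)"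
        by (simp add: inner_commute[of _ y])
      from diff_chain_at[OF this cutoff_has_derivative[unfolded has_field_derivative_def]]
      show ?thesis by (simp add: \<phi>_def[abs_def] \<phi>'_def[abs_def] o_def)
    qed
    have ratio: "(y \<bullet> y) / R\<^sup>2 \<le> 1 \<longleftrightarrow> norm y \<le> R" for y :: 'e
      using Rpos abs_le_square_iff[of "norm y" R] by (simp add: dot_square_norm divide_le_eq_1)
    have ratio2: "2 \<le> (y \<bullet> y) / R\<^sup>2" if "2 * R \<le> norm y" for y :: 'e
    proof -
      have "(2 * R)\<^sup>2 \<le> (norm y)\<^sup>2" using that Rpos by (intro power_mono) auto
      then have "2 * R\<^sup>2 \<le> (norm y)\<^sup>2" using zero_le_power2[of R] by (simp add: power_mult_distrib, linarith)
      then show ?thesis using Rpos by (simp add: dot_square_norm le_divide_eq)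
    qed
    define u where "u a y = \<phi> y * V a y" for a y
    define u' where "u' a y v = \<phi>' y v * V a y +
        \<phi> y * (\<Sum>b\<in>Basis. (v \<bullet> b) * T a b y + (y \<bullet> b) * T' a b y v)" for a y v
    have du: "(u a has_derivative u' a y) (at y)" if "a \<in> Basis" for a y
    proof -
      have "((\<lambda>y. (y \<bullet> b) * T a b y) has_derivative (\<lambda>v. (v \<bullet> b) * T a b y + (y \<bullet> b) * T' a b y v)) (at y)"
        if "b \<in> Basis" for b
        by (auto intro!: derivative_eq_intros T[OF \<open>a \<in> Basis\<close> that])
      then have "(V a has_derivative (\<lambda>v. \<Sum>b\<in>Basis. (v \<bullet> b) * T a b y + (y \<bullet> b) * T' a b y v)) (at y)"
        unfolding V_def[abs_def] by (intro has_derivative_sum)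
      from has_derivative_mult[OF d\<phi> this]
      show ?thesis unfolding u_def[abs_def] u'_def by (simp add: add.commute)
    qed
    have c\<phi>: "continuous_on UNIV \<phi>"
      by (intro continuous_at_imp_continuous_on ballI has_derivative_continuous[OF d\<phi>])
    have c\<phi>': "continuous_on UNIV (\<lambda>y. \<phi>' y v)" for v
      unfolding \<phi>'_def by (intro continuous_intros continuous_on_compose2[OF cutoff'_continuous[of UNIV]]) (use Rpos in auto)
    have cu': "continuous_on UNIV (\<lambda>y. u' a y a)" if "a \<in> Basis" for a
      unfolding u'_def V_def by (intro continuous_intros c\<phi> c\<phi>' contT cont that)
    have supp: "u a y = 0" if "2 * R < norm y" for a y
      using ratio2[of y] that by (simp add: u_def \<phi>_def cutoff_eq_0)
    \<comment> \<open>\<open>W\<close> collects the terms in which the derivative falls on the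
      cutoff. The others add up to \<open>\<phi> y * tr y\<close>, since the derivatives of
      \<open>T\<close> cancel by \<open>div\<close>.\<close>
    define W where "W y = (\<Sum>a\<in>Basis. \<phi>' y a * V a y)" for y
    have sum_u': "(\<Sum>a\<in>Basis. u' a y a) = W y + \<phi> y * tr y" for y
    proof -
      have "(\<Sum>a\<in>Basis. \<Sum>b\<in>Basis. (y \<bullet> b) * T' a b y a) = (\<Sum>b\<in>Basis. (y \<bullet> b) * (\<Sum>a\<in>Basis. T' a b y a))"
        unfolding sum_distrib_left by (rule sum.swap)
      also have "\<dots> = 0" by (simp add: div)
      finally have 1: "(\<Sum>a\<in>Basis. \<Sum>b\<in>Basis. (y \<bullet> b) * T' a b y a) = 0" .
      have "(\<Sum>b\<in>Basis. (a \<bullet> b) * T a b y) = T a a y" if "a \<in> Basis" for a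
        using that by (simp add: inner_Basis if_distrib[of "\<lambda>x. x * _"] cong: if_cong)
      then have "(\<Sum>a\<in>Basis. \<Sum>b\<in>Basis. (a \<bullet> b) * T a b y) = tr y" by (simp add: tr_def)
      with 1 show ?thesis
        by (simp add: u'_def W_def sum.distrib flip: sum_distrib_left)
    qed
    have int0: "integrable lborel (\<lambda>y. u' a y a)" "(\<integral>y. u' a y a \<partial>lborel) = 0" if "a \<in> Basis" for a
      using integral_directional_derivative_eq_0[OF du[OF that] cu'[OF that] supp] by auto
    have "(\<integral>y. W y + \<phi> y * tr y \<partial>lborel) = (\<Sum>a\<in>Basis. \<integral>y. u' a y a \<partial>lborel)"
      unfolding sum_u'[symmetric] by (rule Bochner_Integration.integral_sum) (rule int0)
    then have tot: "(\<integral>y. W y + \<phi> y * tr y \<partial>lborel) = 0" by (simp add: int0)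
    have W0: "W y = 0" if "norm y \<le> R \<or> 2 * R \<le> norm y" for y
      using that ratio[of y] ratio2[of y] by (auto simp: W_def \<phi>'_def cutoff'_eq_0)
    have iW: "integrable lborel W"
      unfolding W_def V_def
      by (rule integrable_compact_support[of _ "2 * R"], intro continuous_intros c\<phi>' contT)
        (use W0[unfolded W_def V_def] in auto)
    have i\<phi>: "integrable lborel (\<lambda>y. \<phi> y * tr y)"
      by (rule integrable_compact_support[of _ "2 * R"], intro continuous_intros c\<phi> cont_tr)
        (use ratio2 in \<open>auto simp: \<phi>_def cutoff_eq_0\<close>)
    define B where "B = 4 * ?m\<^sup>2 * (8 * C) * R powr - (?m + \<beta>)"
    have Wb: "- W y \<le> indicator (cball 0 (2 * R)) y * B" for y
    proof (cases "norm y \<le> R \<or> 2 * R \<le> norm y")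
      case True
      then show ?thesis using pos(3) by (simp add: W0 B_def)
    next
      case False
      then have y: "R < norm y" "norm y < 2 * R" by auto
      have "\<bar>\<phi>' y a * V a y\<bar> \<le> 4 * ?m * (8 * C) * R powr - (?m + \<beta>)" if a: "a \<in> Basis" for a
      proof -
        have 1: "\<bar>\<phi>' y a\<bar> \<le> 4 * (2 * norm y / R\<^sup>2)"
          unfolding \<phi>'_def abs_mult
        proof (rule mult_mono)
          show "\<bar>2 * (y \<bullet> a) / R\<^sup>2\<bar> \<le> 2 * norm y / R\<^sup>2"
            using Basis_le_norm[OF a, of y] by (simp add: divide_right_mono)
        qed (auto simp: cutoff'_bound)
        have "\<bar>(y \<bullet> b) * T a b y\<bar> \<le> norm y * (C * R powr - (?m + \<beta>))" if b: "b \<in> Basis" for b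
          unfolding abs_mult
        proof (rule mult_mono)
          have "\<bar>T a b y\<bar> \<le> C * norm y powr - (?m + \<beta>)" using y R by (intro decay a b) auto
          also have "\<dots> \<le> C * R powr - (?m + \<beta>)"
            using y Rpos pos by (intro mult_left_mono powr_mono2') auto
          finally show "\<bar>T a b y\<bar> \<le> C * R powr - (?m + \<beta>)" .
        qed (use Basis_le_norm[OF b, of y] in auto)
        then have 2: "\<bar>V a y\<bar> \<le> ?m * (norm y * (C * R powr - (?m + \<beta>)))"
          unfolding V_def by (intro order_trans[OF sum_abs] sum_bounded_above) auto
        have "\<bar>\<phi>' y a * V a y\<bar> \<le> (4 * (2 * norm y / R\<^sup>2)) * (?m * (norm y * (C * R powr - (?m + \<beta>))))"
          unfolding abs_mult by (rule mult_mono[OF 1 2]) auto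
        also have "\<dots> = ((norm y)\<^sup>2 / R\<^sup>2) * (8 * ?m * C * R powr - (?m + \<beta>))"
          by (simp add: power2_eq_square)
        also have "\<dots> \<le> 4 * (8 * ?m * C * R powr - (?m + \<beta>))"
        proof (rule mult_right_mono)
          have "(norm y)\<^sup>2 \<le> (2 * R)\<^sup>2" using y by (intro power_mono) auto
          then show "(norm y)\<^sup>2 / R\<^sup>2 \<le> 4" using Rpos by (simp add: divide_le_eq power_mult_distrib)
        qed (use pos in auto)
        finally show ?thesis by (simp add: mult_ac)
      qed
      then have "\<bar>W y\<bar> \<le> ?m * (4 * ?m * (8 * C) * R powr - (?m + \<beta>))"
        unfolding W_def by (intro order_trans[OF sum_abs] sum_bounded_above) auto
      then have "- W y \<le> B" by (simp add: B_def power2_eq_square mult_ac)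
      then show ?thesis using y by (simp add: indicator_def)
    qed
    have fin: "emeasure lborel (cball (0::'e) (2 * R)) < \<infinity>" "emeasure lborel (ball x d) < \<infinity>"
      using emeasure_lborel_cball_finite emeasure_lborel_ball_finite by auto
    have "M = (\<integral>y. indicator (ball x d) y * (tr x / 2) \<partial>lborel)"
      by (simp add: M_def)
    also have "\<dots> \<le> (\<integral>y. \<phi> y * tr y \<partial>lborel)"
    proof (rule integral_mono[OF _ i\<phi>])
      show "integrable lborel (\<lambda>y. indicator (ball x d) y * (tr x / 2))"
        using fin by (intro integrable_mult_left integrable_real_indicator) auto
      fix y
      show "indicator (ball x d) y * (tr x / 2) \<le> \<phi> y * tr y"
      proof (cases "y \<in> ball x d")
        case True
        have "norm y \<le> norm x + norm (y - x)" by (metis add.commute diff_add_cancel norm_triangle_ineq)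
        then have "norm y \<le> R" using True R by (simp add: dist_norm norm_minus_commute)
        then have "\<phi> y = 1" using ratio[of y] by (simp add: \<phi>_def cutoff_eq_1)
        moreover have "\<bar>tr y - tr x\<bar> < tr x / 2" using True by (intro d(2)) (simp add: dist_commute)
        then have "tr x / 2 \<le> tr y" by linarith
        ultimately show ?thesis using True by (simp add: indicator_def)
      next
        case False
        then show ?thesis using nonneg[of y] by (simp add: \<phi>_def cutoff_nonneg tr_def)
      qed
    qed
    also have "\<dots> = (\<integral>y. - W y \<partial>lborel)"
      using tot by (simp add: Bochner_Integration.integral_add[OF iW i\<phi>])
    also have "\<dots> \<le> (\<integral>y. indicator (cball (0::'e) (2 * R)) y * B \<partial>lborel)"
      by (rule integral_mono) (use iW Wb fin in \<open>auto intro!: integrable_mult_left integrable_real_indicator\<close>)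
    also have "\<dots> = measure lborel (cball (0::'e) (2 * R)) * B" by simp
    also have "measure lborel (cball (0::'e) (2 * R)) = (2 * R) powr ?m * measure lborel (cball (0::'e) 1)"
      using Rpos content_cball[of "2 * R" "0::'e"] content_cball[of 1 "0::'e"]
      by (simp add: measure_completion powr_realpow)
    also have "(2 * R) powr ?m * measure lborel (cball (0::'e) 1) * B
        = K * (R powr ?m * R powr - (?m + \<beta>))"
      using Rpos by (simp add: B_def K_def powr_mult)
    \<comment> \<open>Volume growth meets decay: the excess \<open>\<beta>\<close> over the real
      dimension is what survives.\<close>
    also have "R powr ?m * R powr - (?m + \<beta>) = R powr - \<beta>"
      by (simp flip: powr_add)
    finally show ?thesis .
  qed
  have "((\<lambda>R. K * R powr - \<beta>) \<longlongrightarrow> K * 0) at_top"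
    using pos by (intro tendsto_mult tendsto_const tendsto_neg_powr filterlim_ident) auto
  moreover have "\<forall>\<^sub>F R in at_top. M \<le> K * R powr - \<beta>"
    using eventually_ge_at_top[of R\<^sub>0] eventually_ge_at_top[of "norm x + d"]
    by eventually_elim (rule est)
  ultimately have "M \<le> K * 0"
    by (intro tendsto_lowerbound[of "\<lambda>R. K * R powr - \<beta>"]) auto
  then show False using M by simp
qed

section \<open>Hermitian and Kaehler linear algebra\<close>

text \<open>The real orthonormal basis consists of the vectors \<open>e\<close> and
  \<open>\<i> *s e\<close> of a unitary frame, so real traces become the frame sums of the energy
  densities.\<close>

lemma sum_Basis_complex_vec:
  "(\<Sum>b\<in>Basis. g (b :: complex ^ 'n)) = (\<Sum>i\<in>UNIV. g (axis i 1) + g (axis i \<i>))"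
proof -
  have B: "(Basis :: (complex ^ 'n) set) = (\<Union>i\<in>UNIV. {axis i 1, axis i \<i>})"
    by (auto simp: Basis_vec_def Basis_complex_def)
  have "(\<Sum>b\<in>Basis. g (b :: complex ^ 'n)) = (\<Sum>i\<in>UNIV. sum g {axis i 1, axis i \<i>})"
    unfolding B by (rule sum.UNION_disjoint) (auto simp: axis_eq_axis)
  then show ?thesis by (simp add: axis_eq_axis)
qed

lemma ii_scale_axis [simp]:
  "\<i> *s axis i 1 = (axis i \<i> :: complex ^ 'n)" "\<i> *s axis i \<i> = - (axis i 1 :: complex ^ 'n)"
  by (simp_all add: vec_eq_iff axis_def)

lemma ii_scale_ii_scale [simp]: "\<i> *s (\<i> *s v) = - (v :: complex ^ 'n)"
  by (simp add: vec_eq_iff)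

lemma linear_ii_scale: "linear (\<lambda>v. \<i> *s (v :: complex ^ 'n))"
  by (rule linearI) (simp_all add: vec_eq_iff scaleR_conv_of_real algebra_simps)

text \<open>Multiplication by \<open>\<i>\<close> permutes the basis up to sign, which an even
  summand does not notice.\<close>

lemma sum_Basis_ii_scale:
  fixes g :: "complex ^ 'n \<Rightarrow> 'b::comm_monoid_add"
  assumes "\<And>v. g (- v) = g v"
  shows "(\<Sum>b\<in>Basis. g (\<i> *s b)) = (\<Sum>b\<in>Basis. g b)"
  by (simp add: sum_Basis_complex_vec assms add.commute)

text \<open>
  Here \<open>L\<close> is the differential of a map into \<open>N\<close> at a point and \<open>h\<close> is the metric of \<open>N\<close>. Then
  \<open>dbar L\<close> is the antilinear part of \<open>L\<close>, and \<open>stress h L\<close> is the stress-energy tensor of the functional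
  \<open>\<integral> dbar_energy h L\<close>.
\<close>

definition dbar :: "(complex ^ 'n \<Rightarrow> complex ^ 'm) \<Rightarrow> complex ^ 'n \<Rightarrow> complex ^ 'm" where
  "dbar L a = (1/2) *\<^sub>R (L a + \<i> *s L (\<i> *s a))"

definition dbar_energy ::
  "(complex ^ 'm \<Rightarrow> complex ^ 'm \<Rightarrow> real) \<Rightarrow> (complex ^ 'n::finite \<Rightarrow> complex ^ 'm) \<Rightarrow> real" where
  "dbar_energy h L = (1/2) * (\<Sum>c\<in>Basis. h (dbar L c) (L c))"

definition stress ::
  "(complex ^ 'm \<Rightarrow> complex ^ 'm \<Rightarrow> real) \<Rightarrow> (complex ^ 'n::finite \<Rightarrow> complex ^ 'm) \<Rightarrow>
    complex ^ 'n \<Rightarrow> complex ^ 'n \<Rightarrow> real" where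
  "stress h L a b = (a \<bullet> b) * dbar_energy h L - h (dbar L a) (L b)"

text \<open>Meant for \<open>T\<close> the derivative of a transition map: being complex linear it
  commutes with \<open>dbar\<close>, and being an isometry it preserves all products.\<close>

lemma stress_invariant:
  assumes T: "linear T" "\<And>v. T (\<i> *s v) = \<i> *s T v" and h: "\<And>v w. h v w = h' (T v) (T w)"
  shows "stress h L a b = stress h' (\<lambda>v. T (L v)) a b"
proof -
  have "T (dbar L a) = dbar (\<lambda>v. T (L v)) a" for a
    by (simp add: dbar_def linear_cmul[OF T(1)] linear_add[OF T(1)] T(2))
  then show ?thesis by (simp add: stress_def dbar_energy_def h)
qed

lemma dbar_ii_scale:
  assumes "linear L"
  shows "dbar L (\<i> *s a) = - (\<i> *s dbar L a)"
  by (simp add: dbar_def linear_neg[OF assms] linear_cmul[OF linear_ii_scale] linear_add[OF linear_ii_scale]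
      linear_neg[OF linear_ii_scale] algebra_simps)

lemma dbar_linear:
  assumes "linear L"
  shows "linear (dbar L)"
  unfolding dbar_def
  by (intro linear_compose_scale_right linear_compose_add assms linear_compose[OF assms linear_ii_scale, unfolded o_def]
      linear_compose[OF linear_ii_scale linear_compose[OF assms linear_ii_scale], unfolded o_def])

locale hermitian_inner =
  fixes h :: "complex ^ 'm \<Rightarrow> complex ^ 'm \<Rightarrow> real"
  assumes bilin: "bilinear h"
    and sym: "h v w = h w v"
    and pos: "v \<noteq> 0 \<Longrightarrow> 0 < h v v"
    and herm: "h (\<i> *s v) (\<i> *s w) = h v w"
begin

lemmas add_left = bilinear_ladd[OF bilin] and add_right = bilinear_radd[OF bilin]
  and scale_left = bilinear_lmul[OF bilin] and scale_right = bilinear_rmul[OF bilin]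
  and minus_left = bilinear_lneg[OF bilin] and minus_right = bilinear_rneg[OF bilin]
  and zero_left = bilinear_lzero[OF bilin] and zero_right = bilinear_rzero[OF bilin]
  and diff_left = bilinear_lsub[OF bilin] and diff_right = bilinear_rsub[OF bilin]

lemma sum_left: "h (\<Sum>i\<in>A. g i) w = (\<Sum>i\<in>A. h (g i) w)"
  using bilin unfolding bilinear_def by (simp add: linear_sum[of "\<lambda>v. h v w"])

lemma nonneg: "0 \<le> h v v"
  using pos[of v] by (cases "v = 0") (auto simp: zero_left)

lemma skew: "h (\<i> *s v) w = - h v (\<i> *s w)"
  using herm[of v "\<i> *s w"] by (simp add: minus_right)

lemma eq_iff: "v = w \<longleftrightarrow> (\<forall>z. h v z = h w z)"
proof
  assume "\<forall>z. h v z = h w z"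
  then have "h (v - w) (v - w) = 0" by (simp add: diff_left)
  then show "v = w" using pos[of "v - w"] by fastforce
qed simp

lemma Cauchy_Schwarz: "(h v w)\<^sup>2 \<le> h v v * h w w"
proof (cases "w = 0")
  case False
  \<comment> \<open>\<open>h w w\<close> times the component of \<open>v\<close> orthogonal to
    \<open>w\<close>; the scaling avoids a division.\<close>
  let ?z = "h w w *\<^sub>R v - h v w *\<^sub>R w"
  have "0 \<le> h ?z ?z" by (rule nonneg)
  also have "\<dots> = h w w * (h v v * h w w - (h v w)\<^sup>2)"
    by (simp add: diff_left diff_right scale_left scale_right sym[of w v] power2_eq_square algebra_simps)
  finally show ?thesis using pos[OF False] by (simp add: zero_le_mult_iff)
qed (simp add: zero_right)

text \<open>\<open>dbar\<close> is an orthogonal projection for the inner product \<open>\<Sum>c. h (A c) (L c)\<close> of linear maps.\<close>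

lemma sum_dbar_left:
  fixes L A :: "complex ^ 'n \<Rightarrow> complex ^ 'm"
  assumes L: "linear L" and A: "linear A"
  shows "(\<Sum>c\<in>Basis. h (dbar A c) (L c)) = (\<Sum>c\<in>Basis. h (dbar L c) (A c))"
proof -
  \<comment> \<open>Reindexing by \<open>\<i> *s c\<close> moves the complex structure of the domain
    from \<open>A\<close> to \<open>L\<close>; the sign from its square cancels the one from
    \<open>skew\<close>.\<close>
  have "(\<Sum>c\<in>Basis. h (\<i> *s A (\<i> *s c)) (L c)) = (\<Sum>c\<in>Basis. h (\<i> *s A (\<i> *s (\<i> *s c))) (L (\<i> *s c)))"
    by (rule sum_Basis_ii_scale[symmetric])
      (simp add: linear_neg[OF A] linear_neg[OF L] linear_neg[OF linear_ii_scale] minus_left minus_right)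
  also have "\<dots> = (\<Sum>c\<in>Basis. h (A c) (\<i> *s L (\<i> *s c)))"
    by (simp add: linear_neg[OF A] linear_neg[OF linear_ii_scale] minus_left skew)
  also have "\<dots> = (\<Sum>c\<in>Basis. h (\<i> *s L (\<i> *s c)) (A c))"
    by (simp only: sym)
  finally show ?thesis
    by (simp add: dbar_def add_left scale_left sum.distrib sym[of "A _" "L _"] flip: sum_distrib_left sum_divide_distrib)
qed

lemma sum_dbar_dbar:
  fixes L A :: "complex ^ 'n \<Rightarrow> complex ^ 'm"
  assumes L: "linear L"
  shows "(\<Sum>c\<in>Basis. h (dbar L c) (dbar L c)) = (\<Sum>c\<in>Basis. h (dbar L c) (L c))"
proof -
  \<comment> \<open>Idempotence: \<open>dbar L\<close> is antilinear, so both halves of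
    \<open>dbar (dbar L) c\<close> agree. Self-adjointness with \<open>A = dbar L\<close> then gives
    the claim.\<close>
  have "dbar (dbar L) c = dbar L c" for c
    using dbar_ii_scale[OF L, of c]
    by (simp add: dbar_def[of "dbar L"] linear_neg[OF linear_ii_scale] flip: scaleR_2)
  then show ?thesis using sum_dbar_left[OF L dbar_linear[OF L]] by simp
qed

lemma dbar_energy_eq:
  assumes "linear L"
  shows "dbar_energy h L = (1/2) * (\<Sum>c\<in>Basis. h (dbar L c) (dbar L c))"
  using sum_dbar_dbar[OF assms] by (simp add: dbar_energy_def)

lemma dbar_energy_nonneg: "linear L \<Longrightarrow> 0 \<le> dbar_energy h L"
  by (simp add: dbar_energy_eq sum_nonneg nonneg)

text \<open>Pythagoras for the projection \<open>dbar\<close>, dropping the complex linear part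
  \<open>L - dbar L\<close>.\<close>

lemma dbar_energy_le:
  fixes L :: "complex ^ 'n \<Rightarrow> complex ^ 'm"
  assumes L: "linear L"
  shows "dbar_energy h L \<le> (1/2) * (\<Sum>c\<in>Basis. h (L c) (L c))"
proof -
  have "(\<Sum>c\<in>Basis. h (L c) (L c)) =
      (\<Sum>c\<in>Basis. h (L c - dbar L c) (L c - dbar L c)) + 2 * (\<Sum>c\<in>Basis. h (dbar L c) (L c))
      - (\<Sum>c\<in>Basis. h (dbar L c) (dbar L c))"
    by (simp add: diff_left diff_right sum.distrib sum_subtractf sum_distrib_left sym[of "L _" "dbar L _"])
  moreover have "0 \<le> (\<Sum>c\<in>Basis. h (L c - dbar L c) (L c - dbar L c))"
    by (intro sum_nonneg nonneg)
  ultimately show ?thesis by (simp add: dbar_energy_def sum_dbar_dbar[OF L])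
qed

lemma dbar_energy_eq_0:
  fixes L :: "complex ^ 'n \<Rightarrow> complex ^ 'm"
  assumes L: "linear L" and "dbar_energy h L = 0"
  shows "L (\<i> *s v) = \<i> *s L v"
proof -
  have "dbar L c = 0" if "c \<in> Basis" for c
    using assms(2) that pos[of "dbar L c"]
    by (force simp: dbar_energy_eq[OF L] sum_nonneg_eq_0_iff nonneg)
  then have "dbar L v = (\<lambda>_. 0) v"
    using linear_eq_stdbasis[OF dbar_linear[OF L] linear_zero] by metis
  \<comment> \<open>Multiplying \<open>dbar L v = 0\<close> by \<open>\<i>\<close> leaves exactly
    the difference of the two sides of the claim.\<close>
  then have "\<i> *s (L v + \<i> *s L (\<i> *s v)) = \<i> *s 0" by (simp add: dbar_def)
  then show ?thesis by (simp add: linear_add[OF linear_ii_scale] linear_0[OF linear_ii_scale])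
qed

text \<open>The Kronecker delta contributes the real dimension times the energy, the second term
  removes twice the energy. The factor vanishes in complex dimension 1, where the energy is
  conformally invariant.\<close>

lemma trace_stress:
  fixes L :: "complex ^ 'n \<Rightarrow> complex ^ 'm"
  shows "(\<Sum>a\<in>Basis. stress h L a a) = (2 * real CARD('n) - 2) * dbar_energy h L"
  by (simp add: stress_def sum_subtractf dbar_energy_def algebra_simps flip: sum_distrib_right)

text \<open>The constant is 1 + 2: the diagonal term is below the geometric mean because
  \<open>dbar_energy h L \<le> E\<close>, and Cauchy-Schwarz bounds the other term by twice that
  mean.\<close>

lemma stress_bound:
  fixes L :: "complex ^ 'n \<Rightarrow> complex ^ 'm"
  assumes L: "linear L" and ab: "a \<in> Basis" "b \<in> Basis"
  defines "E \<equiv> (1/2) * (\<Sum>c\<in>Basis. h (L c) (L c))"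
  shows "\<bar>stress h L a b\<bar> \<le> 3 * sqrt (E * dbar_energy h L)"
proof -
  have e: "0 \<le> dbar_energy h L" "dbar_energy h L \<le> E"
    using dbar_energy_nonneg[OF L] dbar_energy_le[OF L] by (auto simp: E_def)
  have 1: "dbar_energy h L \<le> sqrt (E * dbar_energy h L)"
    using e by (intro real_le_rsqrt) (simp add: power2_eq_square mult_right_mono)
  have "h (L b) (L b) \<le> (\<Sum>c\<in>Basis. h (L c) (L c))"
    by (rule member_le_sum) (use ab nonneg in auto)
  then have b: "h (L b) (L b) \<le> 2 * E" by (simp add: E_def)
  have "h (dbar L a) (dbar L a) \<le> (\<Sum>c\<in>Basis. h (dbar L c) (dbar L c))"
    by (rule member_le_sum) (use ab nonneg in auto)
  then have a: "h (dbar L a) (dbar L a) \<le> 2 * dbar_energy h L" by (simp add: dbar_energy_eq[OF L])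
  have "(h (dbar L a) (L b))\<^sup>2 \<le> h (dbar L a) (dbar L a) * h (L b) (L b)" by (rule Cauchy_Schwarz)
  also have "\<dots> \<le> (2 * dbar_energy h L) * (2 * E)"
    by (rule mult_mono[OF a b]) (use e nonneg in auto)
  also have "\<dots> = 4 * (E * dbar_energy h L)" by simp
  finally have "\<bar>h (dbar L a) (L b)\<bar> \<le> sqrt (4 * (E * dbar_energy h L))" by (simp add: real_le_rsqrt)
  also have "\<dots> = 2 * sqrt (E * dbar_energy h L)" by (simp add: real_sqrt_mult)
  finally have 2: "\<bar>h (dbar L a) (L b)\<bar> \<le> 2 * sqrt (E * dbar_energy h L)" .
  have "\<bar>a \<bullet> b\<bar> * dbar_energy h L \<le> 1 * dbar_energy h L"
    using ab e by (intro mult_right_mono) (auto simp: inner_Basis)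
  then have "\<bar>(a \<bullet> b) * dbar_energy h L\<bar> \<le> dbar_energy h L" using e by (simp add: abs_mult)
  then show ?thesis unfolding stress_def using 1 2 by linarith
qed

end

text \<open>
  \<open>H u v w\<close> is the derivative in the direction \<open>u\<close> of the metric, evaluated at the constant fields \<open>v\<close> and \<open>w\<close>;
  \<open>\<Gamma>\<close> is the Christoffel symbol.
\<close>

locale kaehler_jet = hermitian_inner h for h :: "complex ^ 'm \<Rightarrow> complex ^ 'm \<Rightarrow> real" +
  fixes H :: "complex ^ 'm \<Rightarrow> complex ^ 'm \<Rightarrow> complex ^ 'm \<Rightarrow> real"
    and \<Gamma> :: "complex ^ 'm \<Rightarrow> complex ^ 'm \<Rightarrow> complex ^ 'm"
  assumes H_lin1: "linear (\<lambda>u. H u v w)"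
    and H_bilin: "bilinear (H u)"
    and H_sym: "H u v w = H u w v"
    and H_herm: "H u (\<i> *s v) (\<i> *s w) = H u v w"
    and H_closed: "H u (\<i> *s v) w + H v (\<i> *s w) u + H w (\<i> *s u) v = 0"
    and koszul: "2 * h (\<Gamma> u v) w = H u v w + H v u w - H w u v"
begin

lemmas H_add1 = linear_add[OF H_lin1] and H_scale1 = linear_cmul[OF H_lin1]
  and H_add2 = bilinear_ladd[OF H_bilin] and H_scale2 = bilinear_lmul[OF H_bilin]
  and H_add3 = bilinear_radd[OF H_bilin] and H_scale3 = bilinear_rmul[OF H_bilin]
  and H_minus2 = bilinear_lneg[OF H_bilin] and H_minus3 = bilinear_rneg[OF H_bilin]

lemma christoffel_sym: "\<Gamma> u v = \<Gamma> v u"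
proof (subst eq_iff, intro allI)
  show "h (\<Gamma> u v) w = h (\<Gamma> v u) w" for w
    using koszul[of u v w] koszul[of v u w] H_sym[of w u v] by simp
qed

lemma christoffel_linear: "linear (\<Gamma> u)"
proof (rule linearI; subst eq_iff; intro allI)
  show "h (\<Gamma> u (v + w)) z = h (\<Gamma> u v + \<Gamma> u w) z" for v w z
    using koszul[of u "v + w" z] koszul[of u v z] koszul[of u w z]
    by (simp add: H_add1 H_add2 H_add3 add_left)
  show "h (\<Gamma> u (r *\<^sub>R v)) z = h (r *\<^sub>R \<Gamma> u v) z" for r v z
    using koszul[of u "r *\<^sub>R v" z] arg_cong[OF koszul[of u v z], of "\<lambda>x. r * x"]
    by (simp add: H_scale1 H_scale2 H_scale3 scale_left algebra_simps)
qed

lemma christoffel_bilinear: "bilinear \<Gamma>"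
  unfolding bilinear_def using christoffel_linear christoffel_sym by (metis (no_types, lifting) ext)

lemma metric_compatible: "H u v w = h (\<Gamma> u v) w + h v (\<Gamma> u w)"
  using koszul[of u v w] koszul[of u w v] H_sym[of u v w] H_sym[of v u w] H_sym[of w u v]
  by (simp add: sym[of v])

lemma H_skew: "H u (\<i> *s v) w = - H u v (\<i> *s w)"
  using H_herm[of u v "\<i> *s w"] by (simp add: H_minus3)

text \<open>The complex structure is parallel. By the Koszul formula, twice the difference of the
  two sides is the closedness identity at \<open>u, v, w\<close> minus the one at
  \<open>u, \<i> *s v, \<i> *s w\<close>, up to terms that cancel by \<open>H_skew\<close>.\<close>

lemma christoffel_ii_scale: "\<Gamma> u (\<i> *s v) = \<i> *s \<Gamma> u v"
proof (subst eq_iff, intro allI)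
  fix w
  show "h (\<Gamma> u (\<i> *s v)) w = h (\<i> *s \<Gamma> u v) w"
    using koszul[of u "\<i> *s v" w] koszul[of u v "\<i> *s w"] H_skew[of u v w] skew[of "\<Gamma> u v" w]
      H_closed[of u v w] H_closed[of u "\<i> *s v" "\<i> *s w"]
      H_sym[of v "\<i> *s w" u] H_skew[of w u v] H_sym[of "\<i> *s v" "\<i> *s (\<i> *s w)" u]
      H_herm[of "\<i> *s w" u v] H_sym[of "\<i> *s v" w u]
    by (simp add: H_minus2)
qed

lemma dbar_christoffel: "dbar (\<lambda>v. \<Gamma> u (L v)) a = \<Gamma> u (dbar L a)"
  by (simp add: dbar_def linear_add[OF christoffel_linear] linear_cmul[OF christoffel_linear] christoffel_ii_scale)

text \<open>
  \<open>Q u v\<close> stands for the second derivative of the map in the directions \<open>u\<close>, \<open>v\<close>; the left hand side of the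
  conclusion is the divergence of the stress tensor.
\<close>

lemma stress_divergence_eq_0:
  fixes L :: "complex ^ 'n \<Rightarrow> complex ^ 'm" and Q :: "complex ^ 'n \<Rightarrow> complex ^ 'n \<Rightarrow> complex ^ 'm"
  assumes L: "linear L" and Q: "bilinear Q" "\<And>u v. Q u v = Q v u"
    and tension: "(\<Sum>c\<in>Basis. Q c c + \<Gamma> (L c) (L c)) = 0"
    and b: "b \<in> Basis"
  defines "S' \<equiv> \<lambda>u a b. H (L u) (dbar L a) (L b) + h (dbar (Q u) a) (L b) + h (dbar L a) (Q u b)"
  shows "(\<Sum>a\<in>Basis. (a \<bullet> b) * ((1/2) * (\<Sum>c\<in>Basis. S' a c c)) - S' a a b) = 0"
proof -
  \<comment> \<open>\<open>B\<close> is the second fundamental form; \<open>Q\<close> alone is the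
    coordinate Hessian.\<close>
  define B where "B u v = Q u v + \<Gamma> (L u) (L v)" for u v
  have Bb: "bilinear B"
    unfolding B_def bilinear_def
    using Q(1) christoffel_bilinear L
    by (auto simp: bilinear_def intro!: linear_compose_add linear_compose[of L, unfolded o_def])
  then have Bl: "linear (B u)" for u unfolding bilinear_def by blast
  have B_sym: "B u v = B v u" for u v
    using Q(2) christoffel_sym by (simp add: B_def)
  \<comment> \<open>Covariant product rule: \<open>metric_compatible\<close> absorbs
    \<open>H\<close>, and as \<open>\<Gamma>\<close> passes through \<open>dbar\<close>, each
    \<open>Q\<close> becomes a \<open>B\<close>.\<close>
  have S': "S' u a b = h (dbar (B u) a) (L b) + h (dbar L a) (B u b)" for u a b
  proof -
    have "dbar (B u) a = dbar (Q u) a + dbar (\<lambda>v. \<Gamma> (L u) (L v)) a"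
      by (simp add: dbar_def B_def linear_add[OF linear_ii_scale] algebra_simps)
    then show ?thesis
      unfolding S'_def metric_compatible by (simp add: dbar_christoffel B_def add_left add_right)
  qed
  \<comment> \<open>Symmetric \<open>B\<close> against the skew complex structure: reindexing by
    \<open>\<i>\<close> shows that the sum equals its negative.\<close>
  have "(\<Sum>a\<in>Basis. B a (\<i> *s a)) = (\<Sum>a\<in>Basis. B (\<i> *s a) (\<i> *s (\<i> *s a)))"
    by (rule sum_Basis_ii_scale[symmetric])
      (simp add: bilinear_lneg[OF Bb] bilinear_rneg[OF Bb] linear_neg[OF linear_ii_scale])
  also have "\<dots> = - (\<Sum>a\<in>Basis. B a (\<i> *s a))"
    by (simp add: bilinear_rneg[OF Bb] B_sym[of "\<i> *s _"] sum_negf)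
  finally have "2 *\<^sub>R (\<Sum>a\<in>Basis. B a (\<i> *s a)) = 0"
    by (metis add.left_inverse scaleR_2)
  then have "(\<Sum>a\<in>Basis. B a (\<i> *s a)) = 0" by simp
  moreover have "(\<Sum>a\<in>Basis. B a a) = 0" using tension by (simp add: B_def)
  moreover have "(\<Sum>a\<in>Basis. dbar (B a) a) =
      (1/2) *\<^sub>R ((\<Sum>a\<in>Basis. B a a) + \<i> *s (\<Sum>a\<in>Basis. B a (\<i> *s a)))"
    unfolding dbar_def by (simp add: linear_sum[OF linear_ii_scale] sum.distrib flip: scaleR_sum_right)
  \<comment> \<open>The antilinear part of the differential is divergence free; this is where
    harmonicity enters.\<close>
  ultimately have "(\<Sum>a\<in>Basis. dbar (B a) a) = 0"
    by (simp add: linear_0[OF linear_ii_scale])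
  then have 1: "(\<Sum>a\<in>Basis. h (dbar (B a) a) (L b)) = 0"
    by (simp add: zero_left flip: sum_left)
  have delta: "(\<Sum>a\<in>Basis. (a \<bullet> b) * G a) = G b" for G :: "complex ^ 'n \<Rightarrow> real"
    using b by (simp add: inner_Basis if_distrib[of "\<lambda>x. x * _"] cong: if_cong)
  have "(\<Sum>a\<in>Basis. (a \<bullet> b) * ((1/2) * (\<Sum>c\<in>Basis. S' a c c))) = (1/2) * (\<Sum>c\<in>Basis. S' b c c)"
    by (rule delta)
  \<comment> \<open>Self-adjointness of \<open>dbar\<close> makes the two halves of
    \<open>S'\<close> equal. Symmetry of \<open>B\<close> then turns this gradient of the energy
    into the remaining divergence term.\<close>
  also have "\<dots> = (\<Sum>c\<in>Basis. h (dbar L c) (B b c))"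
    unfolding S' sum.distrib sum_dbar_left[OF L Bl] by simp
  also have "\<dots> = (\<Sum>a\<in>Basis. S' a a b)"
    unfolding S' sum.distrib 1 by (simp add: B_sym[of b])
  finally show ?thesis by (simp add: sum_subtractf)
qed

end

section \<open>The stress-energy tensor of a map\<close>

text \<open>Smoothness of the metric is assumed on constant vectors only; the expansion reduces
  variable vector arguments to products of scalar functions.\<close>

lemma bilinear_expansion:
  fixes h :: "'a::euclidean_space \<Rightarrow> 'b::euclidean_space \<Rightarrow> real"
  assumes "bilinear h"
  shows "h v w = (\<Sum>i\<in>Basis. \<Sum>j\<in>Basis. (v \<bullet> i) * (w \<bullet> j) * h i j)"
proof -
  have l: "linear (\<lambda>v. h v w)" "linear (h v)" for v w using assms by (auto simp: bilinear_def)
  have "h v w = h (\<Sum>i\<in>Basis. (v \<bullet> i) *\<^sub>R i) w" by (simp add: euclidean_representation)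
  also have "\<dots> = (\<Sum>i\<in>Basis. (v \<bullet> i) * h i w)"
    by (simp add: linear_sum[OF l(1)] linear_cmul[OF l(1)])
  also have "\<dots> = (\<Sum>i\<in>Basis. (v \<bullet> i) * h i (\<Sum>j\<in>Basis. (w \<bullet> j) *\<^sub>R j))"
    by (simp add: euclidean_representation)
  also have "\<dots> = (\<Sum>i\<in>Basis. \<Sum>j\<in>Basis. (v \<bullet> i) * (w \<bullet> j) * h i j)"
    by (simp add: linear_sum[OF l(2)] linear_cmul[OF l(2)] sum_distrib_left mult.assoc)
  finally show ?thesis .
qed

abbreviation metric_derivative ::
  "('a, 'm::finite) metric_manifold \<Rightarrow> ('a, 'm) chart \<Rightarrow> complex ^ 'm \<Rightarrow>
    complex ^ 'm \<Rightarrow> complex ^ 'm \<Rightarrow> complex ^ 'm \<Rightarrow> real" where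
  "metric_derivative N c x u v w \<equiv> frechet_derivative (\<lambda>y. metric_in N c y v w) (at x) u"

section \<open>The Kaehler axioms at a point of a chart\<close>

lemma kaehler_manifoldD:
  assumes "kaehler_manifold N" "c \<in> atlas N"
  shows "open (chart_img c)" "\<And>v w. smooth_on (\<lambda>x. metric_in N c x v w) (chart_img c)"
proof -
  show "open (chart_img c)"
    using assms unfolding kaehler_manifold_def complex_manifold_def chart_on_def by blast
  show "smooth_on (\<lambda>x. metric_in N c x v w) (chart_img c)" for v w
    using assms unfolding kaehler_manifold_def hermitian_metric_def riemannian_metric_def by blast
qed

lemma hermitian_inner_metric_in:
  assumes "kaehler_manifold N" "c \<in> atlas N" "x \<in> chart_img c"
  shows "hermitian_inner (metric_in N c x)"
proof
  have R: "riemannian_metric N" and h: "hermitian_metric N"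
    using assms(1) unfolding kaehler_manifold_def hermitian_metric_def by blast+
  show "bilinear (metric_in N c x)" "metric_in N c x v w = metric_in N c x w v"
    "v \<noteq> 0 \<Longrightarrow> 0 < metric_in N c x v v" for v w
    using R assms unfolding riemannian_metric_def by blast+
  show "metric_in N c x (\<i> *s v) (\<i> *s w) = metric_in N c x v w" for v w
    using h assms unfolding hermitian_metric_def by blast
qed

lemma metric_in_has_derivative:
  assumes "kaehler_manifold N" "c \<in> atlas N" "x \<in> chart_img c"
  shows "((\<lambda>y. metric_in N c y v w) has_derivative (\<lambda>u. metric_derivative N c x u v w)) (at x)"
  using smooth_on_differentiable[OF kaehler_manifoldD(2)[OF assms(1,2)] assms(3)] .

text \<open>Chart images are open, so pointwise identities of the metric (bilinearity, symmetry,
  Hermitian invariance) may be differentiated.\<close>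

lemma metric_derivative_eqI:
  assumes N: "kaehler_manifold N" "c \<in> atlas N" "x \<in> chart_img c"
    and "(k has_derivative D) (at x)" "\<And>y. y \<in> chart_img c \<Longrightarrow> k y = metric_in N c y v w"
  shows "metric_derivative N c x u v w = D u"
proof -
  have "((\<lambda>y. metric_in N c y v w) has_derivative D) (at x)"
    by (rule has_derivative_transform_within_open[OF assms(4) kaehler_manifoldD(1)[OF N(1,2)] N(3)])
      (rule assms(5))
  from frechet_derivative_at[OF this] show ?thesis by simp
qed

lemma bilinear_metric_derivative:
  assumes N: "kaehler_manifold N" "c \<in> atlas N" "x \<in> chart_img c"
  shows "bilinear (metric_derivative N c x u)"
proof -
  note d = metric_in_has_derivative[OF N]
  have bl: "bilinear (metric_in N c y)" if "y \<in> chart_img c" for y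
    using hermitian_inner_metric_in[OF N(1,2) that] by (rule hermitian_inner.bilin)
  have "linear (metric_derivative N c x u v)" for v
  proof (rule linearI)
    show "metric_derivative N c x u v (w + z) = metric_derivative N c x u v w + metric_derivative N c x u v z" for w z
      by (rule metric_derivative_eqI[OF N has_derivative_add[OF d d]]) (simp add: bilinear_radd[OF bl])
    show "metric_derivative N c x u v (r *\<^sub>R w) = r *\<^sub>R metric_derivative N c x u v w" for r w
      by (rule metric_derivative_eqI[OF N has_derivative_scaleR_right[OF d]]) (simp add: bilinear_rmul[OF bl])
  qed
  moreover have "linear (\<lambda>v. metric_derivative N c x u v w)" for w
  proof (rule linearI)
    show "metric_derivative N c x u (v + z) w = metric_derivative N c x u v w + metric_derivative N c x u z w" for v z
      by (rule metric_derivative_eqI[OF N has_derivative_add[OF d d]]) (simp add: bilinear_ladd[OF bl])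
    show "metric_derivative N c x u (r *\<^sub>R v) w = r *\<^sub>R metric_derivative N c x u v w" for r v
      by (rule metric_derivative_eqI[OF N has_derivative_scaleR_right[OF d]]) (simp add: bilinear_lmul[OF bl])
  qed
  ultimately show ?thesis unfolding bilinear_def by blast
qed

lemma kaehler_jet_metric_in:
  assumes N: "kaehler_manifold N" "c \<in> atlas N" "x \<in> chart_img c"
  shows "kaehler_jet (metric_in N c x) (metric_derivative N c x) (christoffel N c x)"
proof -
  note d = metric_in_has_derivative[OF N] and hi = hermitian_inner_metric_in[OF N(1,2)]
  have sym': "metric_derivative N c x u v w = metric_derivative N c x u w v" for u v w
    by (rule metric_derivative_eqI[OF N d]) (rule hermitian_inner.sym[OF hi])
  show ?thesis
  proof (intro kaehler_jet.intro kaehler_jet_axioms.intro)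
    show "hermitian_inner (metric_in N c x)" by (rule hi[OF N(3)])
    show "linear (\<lambda>u. metric_derivative N c x u v w)" for v w
      using d by (rule has_derivative_linear)
    show "bilinear (metric_derivative N c x u)" for u by (rule bilinear_metric_derivative[OF N])
    show "metric_derivative N c x u v w = metric_derivative N c x u w v" for u v w by (rule sym')
    show "metric_derivative N c x u (\<i> *s v) (\<i> *s w) = metric_derivative N c x u v w" for u v w
      by (rule metric_derivative_eqI[OF N d]) (rule hermitian_inner.herm[OF hi, symmetric])
    show "metric_derivative N c x u (\<i> *s v) w + metric_derivative N c x v (\<i> *s w) u +
        metric_derivative N c x w (\<i> *s u) v = 0" for u v w
      using N unfolding kaehler_manifold_def kaehler_form_def by blast
    show "2 * metric_in N c x (christoffel N c x u v) w = metric_derivative N c x u v w +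
        metric_derivative N c x v u w - metric_derivative N c x w u v" for u v w
      using theI'[OF christoffel_unique[OF N, of v u]] unfolding christoffel_def by blast
  qed
qed

text \<open>The chosen chart may jump with \<open>p\<close>, so regularity is not visible here;
  \<open>stress_tensor_eq\<close> substitutes one fixed chart on an open set.\<close>

definition stress_tensor ::
  "('a, 'm::finite) metric_manifold \<Rightarrow> (complex ^ 'n::finite \<Rightarrow> 'a) \<Rightarrow>
    complex ^ 'n \<Rightarrow> complex ^ 'n \<Rightarrow> complex ^ 'n \<Rightarrow> real" where
  "stress_tensor N f a b p = (let c = chart_at N (f p)
     in stress (metric_in N c (chart_map c (f p))) (differential c f p) a b)"

lemma stress_tensor_eq:
  assumes N: "kaehler_manifold N" and f: "smooth_map N f" and c: "c \<in> atlas N" "f p \<in> chart_dom c"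
  shows "stress_tensor N f a b p = stress (metric_in N c (chart_map c (f p))) (differential c f p) a b"
proof -
  let ?d = "chart_at N (f p)"
  let ?T = "frechet_derivative (transition ?d c) (at (chart_map ?d (f p)))"
  have cm: "complex_manifold N" and R: "riemannian_metric N"
    using N unfolding kaehler_manifold_def hermitian_metric_def by blast+
  note d = chart_at[OF cm f, of p]
  have "complex_differentiable_at (transition ?d c) (chart_map ?d (f p))"
    using cm c d unfolding complex_manifold_def by blast
  then have "linear ?T"
    unfolding complex_differentiable_at_def
    using linear_frechet_derivative[of "transition ?d c" "at (chart_map ?d (f p))"] differentiableI by blast
  moreover have "metric_in N ?d (chart_map ?d (f p)) v w = metric_in N c (chart_map c (f p)) (?T v) (?T w)" for v w
    using R c d unfolding riemannian_metric_def by blast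
  ultimately show ?thesis
    unfolding stress_tensor_def Let_def differential_change_of_chart(1)[OF cm f d c, abs_def]
    using differential_change_of_chart(2)[OF cm f d c]
    by (intro stress_invariant[where T = ?T])
qed

section \<open>Differentiating the stress tensor inside one chart\<close>

locale smooth_map_in_chart =
  fixes N :: "('a, 'm::finite) metric_manifold" and f :: "complex ^ 'n::finite \<Rightarrow> 'a"
    and c :: "('a, 'm) chart"
  assumes N: "kaehler_manifold N" and f: "smooth_map N f" and c: "c \<in> atlas N"
begin

definition U where "U = f -` chart_dom c"
definition F where "F = chart_map c \<circ> f"
definition Q where "Q p u v = frechet_derivative (\<lambda>y. differential c f y v) (at p) u"

lemma U_iff: "p \<in> U \<longleftrightarrow> f p \<in> chart_dom c"
  by (simp add: U_def)

lemma open_U: "open U"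
proof -
  have "chart_on (points N) c" using N c unfolding kaehler_manifold_def complex_manifold_def by blast
  then show ?thesis
    using f unfolding U_def smooth_map_def chart_on_def continuous_map_def vimage_def by simp
qed

lemma F_in_img: "p \<in> U \<Longrightarrow> F p \<in> chart_img c"
  by (simp add: U_def F_def chart_img_def)

lemma smooth_F: "smooth_on F U"
  using f c unfolding smooth_map_def F_def U_def by blast

lemma differential_eq: "differential c f p v = frechet_derivative F (at p) v"
  by (simp add: differential_def F_def)

lemma F_has_derivative: "p \<in> U \<Longrightarrow> (F has_derivative differential c f p) (at p)"
  using smooth_on_differentiable[OF smooth_F] by (simp add: differential_eq[abs_def])

lemma smooth_differential: "smooth_on (\<lambda>p. differential c f p v) U"
  unfolding differential_eq by (rule smooth_on_derivative[OF smooth_F])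

lemma differential_has_derivative:
  "p \<in> U \<Longrightarrow> ((\<lambda>p. differential c f p v) has_derivative (\<lambda>u. Q p u v)) (at p)"
  using smooth_on_differentiable[OF smooth_differential] by (simp add: Q_def)

lemma linear_differential: "p \<in> U \<Longrightarrow> linear (differential c f p)"
  using F_has_derivative by (rule has_derivative_linear)

lemma Q_sym: "p \<in> U \<Longrightarrow> Q p u v = Q p v u"
  unfolding Q_def differential_eq by (rule smooth_on_second_derivative_commute[OF smooth_F open_U])

text \<open>A derivative is linear in its direction; the other slot inherits this through the
  symmetry of second derivatives.\<close>

lemma bilinear_Q:
  assumes "p \<in> U"
  shows "bilinear (Q p)"
proof -
  have 1: "linear (\<lambda>u. Q p u v)" for v
    using differential_has_derivative[OF assms] by (rule has_derivative_linear)
  then have "linear (\<lambda>v. Q p u v)" for u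
    using Q_sym[OF assms, of u] by simp
  with 1 show ?thesis by (simp add: bilinear_def)
qed

lemma kaehler_jet_at:
  "p \<in> U \<Longrightarrow> kaehler_jet (metric_in N c (F p)) (metric_derivative N c (F p)) (christoffel N c (F p))"
  by (rule kaehler_jet_metric_in[OF N c F_in_img])

lemma bilinear_metric: "p \<in> U \<Longrightarrow> bilinear (metric_in N c (F p))"
  by (rule hermitian_inner.bilin[OF hermitian_inner_metric_in[OF N c F_in_img]])

lemma bilinear_metric': "p \<in> U \<Longrightarrow> bilinear (metric_derivative N c (F p) u)"
  by (rule bilinear_metric_derivative[OF N c F_in_img])

lemma continuous_metric:
  assumes "continuous_on U V" "continuous_on U W"
  shows "continuous_on U (\<lambda>p. metric_in N c (F p) (V p) (W p))"
proof -
  have "continuous_on U (\<lambda>p. \<Sum>i\<in>Basis. \<Sum>j\<in>Basis. (V p \<bullet> i) * (W p \<bullet> j) * metric_in N c (F p) i j)"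
    by (intro continuous_intros assms
        continuous_on_compose2[OF smooth_on_continuous[OF kaehler_manifoldD(2)[OF N c]] smooth_on_continuous[OF smooth_F]])
      (use F_in_img in auto)
  then show ?thesis
    by (rule continuous_on_eq) (rule bilinear_expansion[OF bilinear_metric, symmetric])
qed

lemma continuous_metric_derivative:
  assumes "continuous_on U Z" "continuous_on U V" "continuous_on U W"
  shows "continuous_on U (\<lambda>p. metric_derivative N c (F p) (Z p) (V p) (W p))"
proof -
  have 1: "continuous_on U (\<lambda>p. metric_derivative N c (F p) (Z p) i j)" for i j
  proof -
    have "continuous_on U (\<lambda>p. \<Sum>k\<in>Basis. (Z p \<bullet> k) * metric_derivative N c (F p) k i j)"
      by (intro continuous_intros assms continuous_on_compose2[OF smooth_on_continuous
            [OF smooth_on_derivative[OF kaehler_manifoldD(2)[OF N c]]] smooth_on_continuous[OF smooth_F]])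
        (use F_in_img in auto)
    then show ?thesis
    proof (rule continuous_on_eq)
      fix p assume p: "p \<in> U"
      have l: "linear (\<lambda>u. metric_derivative N c (F p) u i j)"
        using metric_in_has_derivative[OF N c F_in_img[OF p]] by (rule has_derivative_linear)
      have "metric_derivative N c (F p) (Z p) i j =
          metric_derivative N c (F p) (\<Sum>k\<in>Basis. (Z p \<bullet> k) *\<^sub>R k) i j"
        by (simp add: euclidean_representation)
      also have "\<dots> = (\<Sum>k\<in>Basis. (Z p \<bullet> k) * metric_derivative N c (F p) k i j)"
        using linear_sum[OF l, of "\<lambda>k. (Z p \<bullet> k) *\<^sub>R k" Basis] linear_cmul[OF l] by simp
      finally show "(\<Sum>k\<in>Basis. (Z p \<bullet> k) * metric_derivative N c (F p) k i j) =
        metric_derivative N c (F p) (Z p) i j" by simp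
    qed
  qed
  have "continuous_on U (\<lambda>p. \<Sum>i\<in>Basis. \<Sum>j\<in>Basis.
      (V p \<bullet> i) * (W p \<bullet> j) * metric_derivative N c (F p) (Z p) i j)"
    by (intro continuous_intros assms 1)
  then show ?thesis
    by (rule continuous_on_eq) (rule bilinear_expansion[OF bilinear_metric', symmetric])
qed

lemma metric_has_derivative:
  assumes p: "p \<in> U" and V: "(V has_derivative V') (at p)" and W: "(W has_derivative W') (at p)"
  shows "((\<lambda>y. metric_in N c (F y) (V y) (W y)) has_derivative
      (\<lambda>u. metric_derivative N c (F p) (differential c f p u) (V p) (W p) +
           metric_in N c (F p) (V' u) (W p) + metric_in N c (F p) (V p) (W' u))) (at p)"
proof -
  note b = bilinear_expansion[OF bilinear_metric] and b' = bilinear_expansion[OF bilinear_metric'[OF p]]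
  have g: "((\<lambda>y. metric_in N c (F y) i j) has_derivative
      (\<lambda>u. metric_derivative N c (F p) (differential c f p u) i j)) (at p)" for i j
    using diff_chain_at[OF F_has_derivative[OF p] metric_in_has_derivative[OF N c F_in_img[OF p]]]
    by (simp add: o_def)
  have "((\<lambda>y. (V y \<bullet> i) * (W y \<bullet> j) * metric_in N c (F y) i j) has_derivative
    (\<lambda>u. (V p \<bullet> i) * (W p \<bullet> j) * metric_derivative N c (F p) (differential c f p u) i j +
         ((V p \<bullet> i) * (W' u \<bullet> j) + (V' u \<bullet> i) * (W p \<bullet> j)) * metric_in N c (F p) i j)) (at p)" for i j
    by (intro has_derivative_mult has_derivative_inner_left g V W)
  then have "((\<lambda>y. \<Sum>i\<in>Basis. \<Sum>j\<in>Basis. (V y \<bullet> i) * (W y \<bullet> j) * metric_in N c (F y) i j) has_derivative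
    (\<lambda>u. \<Sum>i\<in>Basis. \<Sum>j\<in>Basis. (V p \<bullet> i) * (W p \<bullet> j) * metric_derivative N c (F p) (differential c f p u) i j +
         ((V p \<bullet> i) * (W' u \<bullet> j) + (V' u \<bullet> i) * (W p \<bullet> j)) * metric_in N c (F p) i j)) (at p)"
    by (intro has_derivative_sum)
  then have "((\<lambda>y. metric_in N c (F y) (V y) (W y)) has_derivative
    (\<lambda>u. \<Sum>i\<in>Basis. \<Sum>j\<in>Basis. (V p \<bullet> i) * (W p \<bullet> j) * metric_derivative N c (F p) (differential c f p u) i j +
         ((V p \<bullet> i) * (W' u \<bullet> j) + (V' u \<bullet> i) * (W p \<bullet> j)) * metric_in N c (F p) i j)) (at p)"
    by (rule has_derivative_transform_within_open[OF _ open_U p]) (rule b[symmetric])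
  then show ?thesis
    unfolding b'[of "V p" "W p"] b[OF p, of _ "W p"] b[OF p, of "V p"]
    by (simp add: algebra_simps sum.distrib)
qed

text \<open>Product rule for \<open>h (dbar L a) (L b)\<close> along the map, in the shape required
  by \<open>kaehler_jet.stress_divergence_eq_0\<close>.\<close>

definition S' where
  "S' p u a b = metric_derivative N c (F p) (differential c f p u) (dbar (differential c f p) a) (differential c f p b) +
     metric_in N c (F p) (dbar (Q p u) a) (differential c f p b) +
     metric_in N c (F p) (dbar (differential c f p) a) (Q p u b)"

definition stress' where
  "stress' p u a b = (a \<bullet> b) * ((1/2) * (\<Sum>e\<in>Basis. S' p u e e)) - S' p u a b"

lemma stress_has_derivative:
  assumes p: "p \<in> U"
  shows "((\<lambda>p. stress (metric_in N c (F p)) (differential c f p) a b) has_derivative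
    (\<lambda>u. stress' p u a b)) (at p)"
proof -
  note d = differential_has_derivative[OF p]
  have "((\<lambda>p. dbar (differential c f p) a) has_derivative (\<lambda>u. dbar (Q p u) a)) (at p)" for a
    unfolding dbar_def
    by (intro has_derivative_scaleR_right has_derivative_add d
        linear_imp_has_derivative[THEN has_derivative_compose[rotated], OF linear_ii_scale])
  from metric_has_derivative[OF p this d]
  have S: "((\<lambda>p. metric_in N c (F p) (dbar (differential c f p) a) (differential c f p b)) has_derivative
      (\<lambda>u. S' p u a b)) (at p)" for a b
    by (simp add: S'_def)
  show ?thesis
    unfolding stress_def dbar_energy_def stress'_def
    by (intro has_derivative_diff has_derivative_mult_right has_derivative_sum S)
qed

lemma stress_tensor_eq_F:
  "p \<in> U \<Longrightarrow> stress_tensor N f a b p = stress (metric_in N c (F p)) (differential c f p) a b"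
  using stress_tensor_eq[OF N f c, of p] by (simp add: U_iff F_def)

lemma stress_tensor_has_derivative:
  assumes p: "p \<in> U"
  shows "(stress_tensor N f a b has_derivative (\<lambda>u. stress' p u a b)) (at p)"
  by (rule has_derivative_transform_within_open[OF stress_has_derivative[OF p] open_U p])
    (simp add: stress_tensor_eq_F)

lemma continuous_stress': "continuous_on U (\<lambda>p. stress' p u a b)"
proof -
  have d: "continuous_on U (\<lambda>p. differential c f p v)" for v
    by (rule smooth_on_continuous[OF smooth_differential])
  have q: "continuous_on U (\<lambda>p. Q p u v)" for u v
    unfolding Q_def by (rule smooth_on_continuous[OF smooth_on_derivative[OF smooth_differential]])
  have db: "continuous_on U (\<lambda>p. dbar (differential c f p) a)" "continuous_on U (\<lambda>p. dbar (Q p u) a)" for u a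
    unfolding dbar_def
    by (intro continuous_on_scaleR continuous_on_const continuous_on_add d q
        linear_continuous_on_compose[OF _ linear_ii_scale])+
  have "continuous_on U (\<lambda>p. S' p u a b)" for a b
    unfolding S'_def by (intro continuous_on_add continuous_metric_derivative continuous_metric d q db)
  then show ?thesis unfolding stress'_def by (intro continuous_intros)
qed

lemma stress'_divergence:
  assumes p: "p \<in> U" and "tension_field N c f p = 0" and b: "b \<in> Basis"
  shows "(\<Sum>a\<in>Basis. stress' p a a b) = 0"
  unfolding stress'_def S'_def
proof (rule kaehler_jet.stress_divergence_eq_0[OF kaehler_jet_at[OF p] linear_differential[OF p] bilinear_Q[OF p] Q_sym[OF p] _ b])
  show "(\<Sum>e\<in>Basis. Q p e e + christoffel N c (F p) (differential c f p e) (differential c f p e)) = 0"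
    using assms(2) unfolding tension_field_def second_fundamental_form_def Q_def F_def by simp
qed

lemma energy_density_in_sum_Basis:
  "energy_density_in N c f p =
    (1/2) * (\<Sum>b\<in>Basis. metric_in N c (F p) (differential c f p b) (differential c f p b))"
  by (simp add: energy_density_in_def Let_def sum_Basis_complex_vec F_def)

text \<open>In the real trace, \<open>e\<close> and \<open>\<i> *s e\<close> each contribute the
  cross term once, and these agree by skewness; hence the factor 2 in the frame formula.\<close>

lemma dbar_energy_density_in_eq:
  assumes p: "p \<in> U"
  shows "dbar_energy_density_in N c f p = dbar_energy (metric_in N c (F p)) (differential c f p)"
proof -
  interpret hermitian_inner "metric_in N c (F p)" by (rule hermitian_inner_metric_in[OF N c F_in_img[OF p]])
  note l = linear_differential[OF p]
  have skew': "metric_in N c (F p) v (\<i> *s differential c f p (axis i 1)) =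
      - metric_in N c (F p) (differential c f p (axis i 1)) (\<i> *s v)" for v i
    using skew[of "differential c f p (axis i 1)" v] by (simp add: sym)
  show ?thesis
    by (simp add: dbar_energy_density_in_def Let_def dbar_energy_def sum_Basis_complex_vec dbar_def
        F_def[THEN fun_cong, unfolded o_def, symmetric]
        scale_left add_left minus_left skew skew' linear_neg[OF l] linear_neg[OF linear_ii_scale]
        sum_distrib_left algebra_simps)
qed

end

theorem theorem1p1:
  fixes N :: "('a, 'm::finite) metric_manifold"
    and f :: "complex ^ 'n::finite \<Rightarrow> 'a"
    and \<alpha> :: real
  assumes "2 \<le> CARD('n)"
    and "kaehler_manifold N"
    and "harmonic_map N f"
    and "0 < \<alpha>"
    and "\<exists>C>0. \<exists>R\<^sub>0>0. \<forall>p. R\<^sub>0 \<le> norm p \<longrightarrow>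
           energy_density N f p * dbar_energy_density N f p
             \<le> C * norm p powr - (4 * real CARD('n) + \<alpha>)"
  shows "holomorphic_map N f"
proof -
  note N = assms(2)
  have f: "smooth_map N f" and cm: "complex_manifold N"
    using assms(2,3) unfolding harmonic_map_def kaehler_manifold_def by blast+
  obtain C R\<^sub>0 where C: "C > 0" "R\<^sub>0 > 0" and decay: "\<And>p. R\<^sub>0 \<le> norm p \<Longrightarrow>
      energy_density N f p * dbar_energy_density N f p \<le> C * norm p powr - (4 * real CARD('n) + \<alpha>)"
    using assms(5) by blast
  define T where "T = stress_tensor N f"
  \<comment> \<open>A chart-free name for the derivative, identified with \<open>stress'\<close> of
    whichever chart is at hand.\<close>
  define T' where "T' a b p = frechet_derivative (T a b) (at p)" for a b p
  have chart: "smooth_map_in_chart N f c" if "c \<in> atlas N" for c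
    using N f that by unfold_locales
  have tension: "tension_field N c f p = 0" if "c \<in> atlas N" "f p \<in> chart_dom c" for c p
    using assms(3) that unfolding harmonic_map_def by blast
  have local: "\<exists>c\<in>atlas N. f p \<in> chart_dom c" for p
    using chart_at[OF cm f, of p] by blast
  have der: "(T a b has_derivative T' a b p) (at p)"
    and div: "b \<in> Basis \<Longrightarrow> (\<Sum>a\<in>Basis. T' a b p a) = 0"
    and cont: "isCont (\<lambda>p. T' a b p a) p" for a b p
  proof -
    obtain c where ch: "c \<in> atlas N" "f p \<in> chart_dom c" using local by blast
    interpret smooth_map_in_chart N f c by (rule chart[OF ch(1)])
    have p: "p \<in> U" using ch(2) by (simp add: U_iff)
    have d: "(T a b has_derivative (\<lambda>u. stress' q u a b)) (at q)" if "q \<in> U" for a b q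
      unfolding T_def by (rule stress_tensor_has_derivative[OF that])
    have T': "T' a b q = (\<lambda>u. stress' q u a b)" if "q \<in> U" for a b q
      unfolding T'_def using frechet_derivative_at[OF d[OF that]] by simp
    show "(T a b has_derivative T' a b p) (at p)" using d[OF p] by (simp add: T'[OF p])
    show "(\<Sum>a\<in>Basis. T' a b p a) = 0" if "b \<in> Basis"
      using stress'_divergence[OF p tension[OF ch] that] by (simp add: T'[OF p])
    have "continuous_on U (\<lambda>p. T' a b p a)"
      by (rule continuous_on_eq[OF continuous_stress']) (simp add: T')
    then show "isCont (\<lambda>p. T' a b p a) p" using open_U p continuous_on_eq_continuous_at by blast
  qed
  have trace: "(\<Sum>a\<in>Basis. T a a p) = (2 * real CARD('n) - 2) *
        dbar_energy (metric_in N c (chart_map c (f p))) (differential c f p)"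
    and nonneg: "0 \<le> dbar_energy (metric_in N c (chart_map c (f p))) (differential c f p)"
    and bound: "a \<in> Basis \<Longrightarrow> b \<in> Basis \<Longrightarrow>
        \<bar>T a b p\<bar> \<le> 3 * sqrt (energy_density N f p * dbar_energy_density N f p)"
    and hol: "dbar_energy (metric_in N c (chart_map c (f p))) (differential c f p) = 0 \<Longrightarrow>
        differential c f p (\<i> *s v) = \<i> *s differential c f p v"
    if ch: "c \<in> atlas N" "f p \<in> chart_dom c" for p c a b v
  proof -
    interpret smooth_map_in_chart N f c by (rule chart[OF ch(1)])
    have p: "p \<in> U" using ch(2) by (simp add: U_iff)
    have F: "chart_map c (f p) = F p" by (simp add: F_def)
    interpret hermitian_inner "metric_in N c (F p)" by (rule hermitian_inner_metric_in[OF N ch(1) F_in_img[OF p]])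
    note l = linear_differential[OF p]
    show "(\<Sum>a\<in>Basis. T a a p) = (2 * real CARD('n) - 2) *
        dbar_energy (metric_in N c (chart_map c (f p))) (differential c f p)"
      unfolding T_def stress_tensor_eq_F[OF p] F by (rule trace_stress)
    show "0 \<le> dbar_energy (metric_in N c (chart_map c (f p))) (differential c f p)"
      unfolding F by (rule dbar_energy_nonneg[OF l])
    show "\<bar>T a b p\<bar> \<le> 3 * sqrt (energy_density N f p * dbar_energy_density N f p)"
      if "a \<in> Basis" "b \<in> Basis"
      using stress_bound[OF l that]
      by (simp only: T_def stress_tensor_eq_F[OF p] energy_density_eq[OF N f ch] dbar_energy_density_eq[OF N f ch]
          energy_density_in_sum_Basis dbar_energy_density_in_eq[OF p])
    show "differential c f p (\<i> *s v) = \<i> *s differential c f p v"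
      if "dbar_energy (metric_in N c (chart_map c (f p))) (differential c f p) = 0"
      using that unfolding F by (rule dbar_energy_eq_0[OF l])
  qed
  have tr0: "(\<Sum>a\<in>Basis. T a a p) = 0" for p
  proof (rule divergence_free_decay_trace_eq_0[OF der _ div])
    show "continuous_on UNIV (\<lambda>x. T' a b x a)" for a b
      using cont by (simp add: continuous_at_imp_continuous_on)
    show "0 \<le> (\<Sum>a\<in>Basis. T a a x)" for x
      using local[of x] trace nonneg assms(1) by fastforce
    show "\<bar>T a b x\<bar> \<le> 3 * sqrt C * norm x powr - (real DIM(complex ^ 'n) + \<alpha> / 2)"
      if "a \<in> Basis" "b \<in> Basis" "R\<^sub>0 \<le> norm x" for a b x
    proof -
      have "\<bar>T a b x\<bar> \<le> 3 * sqrt (energy_density N f x * dbar_energy_density N f x)"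
        using local[of x] bound that(1,2) by blast
      also have "\<dots> \<le> 3 * sqrt (C * norm x powr - (4 * real CARD('n) + \<alpha>))"
        using decay[OF that(3)] by simp
      \<comment> \<open>The root halves the exponent \<open>4 * real CARD('n) + \<alpha>\<close>,
        leaving the real dimension \<open>2 * CARD('n)\<close> plus the surplus
        \<open>\<alpha> / 2\<close>.\<close>
      also have "\<dots> = 3 * sqrt C * norm x powr (- (4 * real CARD('n) + \<alpha>) * (1/2))"
        by (simp only: real_sqrt_mult powr_powr flip: powr_half_sqrt[OF powr_ge_zero])
      also have "- (4 * real CARD('n) + \<alpha>) * (1/2) = - (real DIM(complex ^ 'n) + \<alpha> / 2)"
        by (simp add: field_simps)
      finally show ?thesis .
    qed
  qed (use C assms(4) in auto)
  have "differential c f p (\<i> *s v) = \<i> *s differential c f p v"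
    if c: "c \<in> atlas N" "f p \<in> chart_dom c" for c p v
  proof (rule hol[OF c])
    \<comment> \<open>From complex dimension 2 on, the factor in \<open>trace\<close> is positive,
      so a vanishing trace forces a vanishing energy.\<close>
    show "dbar_energy (metric_in N c (chart_map c (f p))) (differential c f p) = 0"
      using trace[OF c] tr0[of p] assms(1) by simp
  qed
  then show ?thesis using f unfolding holomorphic_map_def by blast
qed

end
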